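(* Let $k$ be a field, let $R = k[x_1,\ldots,x_n]$ with its standard grading, and let $I$ be an Artinian graded ideal of $R$. Let $\operatorname{mono}(I)$ denote the ideal generated by all monomials contained in $I$. Then for every integer $j$, if $\beta_{n,j}(R/\operatorname{mono}(I)) \neq 0$, then $\beta_{n,j}(R/I) \neq 0$.
   Context: Let $\mathfrak{m} = (x_1,\ldots,x_n)$. A graded ideal $J\subseteq R$ is called Artinian if it is $\mathfrak{m}$-primary, i.e. $J$ is proper and $R/J$ is an Artinian ring. For a finitely generated graded $R$-module $N$, $\beta_{i,j}(N) = \dim_k \operatorname{Tor}_i^R(N,k)_j$ are the graded Betti numbers; here $n$ is the number of variables. *)

theory Defs
  imports
    "HOL-Algebra.Algebra"
    "HOL-Algebra.Algebraic_Closure_Type"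
    "HOL-Library.Cardinality"
    "HOL-Library.Poly_Mapping"
    "HOL-Library.Function_Algebras"
begin

section \<open>Polynomial rings and their ideals\<close>

text \<open>The polynomial ring \<open>k[x\<^sub>1,\<dots>,x\<^sub>n]\<close>: the variables are the elements of the finite type
  \<open>'n\<close>, so \<open>n = CARD('n)\<close>, and a polynomial is a finitely supported function from
  exponent vectors to coefficients.\<close>

type_synonym ('n, 'k) mpoly = "('n \<Rightarrow>\<^sub>0 nat) \<Rightarrow>\<^sub>0 'k"

abbreviation mpoly_ring :: "('n::finite, 'k::field) mpoly ring"
  where "mpoly_ring \<equiv> ring_of_type_algebra"

definition mdeg :: "('n::finite \<Rightarrow>\<^sub>0 nat) \<Rightarrow> nat"
  where "mdeg m = (\<Sum>i\<in>UNIV. Poly_Mapping.lookup m i)"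

text \<open>Degrees are integers because of the shifts \<open>R(-a)\<close>; only \<open>0\<close> is homogeneous of
  negative degree.\<close>

definition homogeneous :: "int \<Rightarrow> ('n::finite, 'k::field) mpoly \<Rightarrow> bool"
  where "homogeneous d p \<longleftrightarrow> (\<forall>m\<in>Poly_Mapping.keys p. int (mdeg m) = d)"

definition hom_component :: "nat \<Rightarrow> ('n::finite, 'k::field) mpoly \<Rightarrow> ('n, 'k) mpoly"
  where "hom_component d p =
    (\<Sum>m | m \<in> Poly_Mapping.keys p \<and> mdeg m = d.
       Poly_Mapping.single m (Poly_Mapping.lookup p m))"

definition graded_ideal :: "('n::finite, 'k::field) mpoly set \<Rightarrow> bool"
  where "graded_ideal J \<longleftrightarrow> ideal J mpoly_ring \<and> (\<forall>p\<in>J. \<forall>d. hom_component d p \<in> J)"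

locale artinian_cring = cring +
  assumes descending_chain:
    "(\<And>i::nat. ideal (C i) R) \<Longrightarrow> (\<And>i. C (Suc i) \<subseteq> C i) \<Longrightarrow> \<exists>m. \<forall>i\<ge>m. C i = C m"

definition artinian_ideal :: "('n::finite, 'k::field) mpoly set \<Rightarrow> bool"
  where "artinian_ideal J \<longleftrightarrow>
    ideal J mpoly_ring \<and> J \<noteq> carrier mpoly_ring \<and> artinian_cring (mpoly_ring Quot J)"

definition monomials :: "('n::finite, 'k::field) mpoly set"
  where "monomials = range (\<lambda>m. Poly_Mapping.single m 1)"

definition mono_ideal :: "('n::finite, 'k::field) mpoly set \<Rightarrow> ('n, 'k) mpoly set"
  where "mono_ideal J = Idl\<^bsub>mpoly_ring\<^esub> (J \<inter> monomials)"

section \<open>Graded free resolutions of \<open>R/J\<close>\<close>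

text \<open>A complex \<open>\<dots> \<rightarrow> F\<^sub>1 \<rightarrow> F\<^sub>0\<close> of graded free modules of finite rank, together with a map from
  \<open>F\<^sub>0\<close> to a cyclic module \<open>R/J\<close>. The module \<open>F\<^sub>i\<close> has a basis indexed by \<open>b < rk F i\<close>, the
  \<open>b\<close>-th basis element being of degree \<open>shift F i b\<close>; thus \<open>F\<^sub>i\<close> is the direct sum of the
  \<open>R(- shift F i b)\<close>. An element of \<open>F\<^sub>i\<close> is given by a coordinate function of which only the
  values at \<open>b < rk F i\<close> matter. The entry \<open>differential F i c b\<close> is the coefficient of the
  \<open>c\<close>-th basis element of \<open>F\<^sub>i\<close> in the image of the \<open>b\<close>-th basis element of \<open>F\<^sub>i\<^sub>+\<^sub>1\<close> (note the
  index), and \<open>augmentation F b\<close> represents the image in \<open>R/J\<close> of the \<open>b\<close>-th basis element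
  of \<open>F\<^sub>0\<close>.\<close>

record (overloaded) ('n, 'k) augmented_free_complex =
  rk :: "nat \<Rightarrow> nat"
  shift :: "nat \<Rightarrow> nat \<Rightarrow> int"
  differential :: "nat \<Rightarrow> nat \<Rightarrow> nat \<Rightarrow> ('n, 'k) mpoly"
  augmentation :: "nat \<Rightarrow> ('n, 'k) mpoly"

definition diff_map ::
    "('n::finite, 'k::field) augmented_free_complex \<Rightarrow> nat \<Rightarrow> (nat \<Rightarrow> ('n, 'k) mpoly) \<Rightarrow>
      nat \<Rightarrow> ('n, 'k) mpoly"
  where "diff_map F i v c = (\<Sum>b<rk F (Suc i). differential F i c b * v b)"

definition aug_map ::
    "('n::finite, 'k::field) augmented_free_complex \<Rightarrow> (nat \<Rightarrow> ('n, 'k) mpoly) \<Rightarrow> ('n, 'k) mpoly"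
  where "aug_map F v = (\<Sum>b<rk F 0. augmentation F b * v b)"

text \<open>The maps are homogeneous of degree \<open>0\<close> and \<open>\<dots> \<rightarrow> F\<^sub>1 \<rightarrow> F\<^sub>0 \<rightarrow> R/J \<rightarrow> 0\<close> is exact: at \<open>R/J\<close>,
  at \<open>F\<^sub>0\<close>, and at every \<open>F\<^sub>i\<^sub>+\<^sub>1\<close>.\<close>

definition graded_free_resolution ::
    "('n::finite, 'k::field) mpoly set \<Rightarrow> ('n, 'k) augmented_free_complex \<Rightarrow> bool"
  where "graded_free_resolution J F \<longleftrightarrow>
    (\<forall>b<rk F 0. homogeneous (shift F 0 b) (augmentation F b)) \<and>
    (\<forall>i. \<forall>c<rk F i. \<forall>b<rk F (Suc i).
       homogeneous (shift F (Suc i) b - shift F i c) (differential F i c b)) \<and>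
    (\<forall>p. \<exists>v. p - aug_map F v \<in> J) \<and>
    (\<forall>v. aug_map F v \<in> J \<longleftrightarrow> (\<exists>w. \<forall>c<rk F 0. v c = diff_map F 0 w c)) \<and>
    (\<forall>i v. (\<forall>c<rk F i. diff_map F i v c = 0) \<longleftrightarrow>
           (\<exists>w. \<forall>b<rk F (Suc i). v b = diff_map F (Suc i) w b))"

section \<open>\<open>Tor\<close> and graded Betti numbers\<close>

text \<open>The residue field \<open>k = R/\<mm>\<close> is the \<open>R\<close>-module on which a polynomial acts through its
  constant term. Hence \<open>F\<^sub>i \<otimes> k\<close> is the \<open>k\<close>-vector space on the basis of \<open>F\<^sub>i\<close>, its part of degree
  \<open>j\<close> is spanned by the basis elements of degree \<open>j\<close>, and the differential of \<open>F \<otimes> k\<close> is given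
  by the matrix of constant terms. Vectors are represented by functions that vanish outside
  the index set of the basis.\<close>

definition const_term :: "('n::finite, 'k::field) mpoly \<Rightarrow> 'k"
  where "const_term p = Poly_Mapping.lookup p 0"

definition tensor_piece ::
    "('n::finite, 'k::field) augmented_free_complex \<Rightarrow> nat \<Rightarrow> int \<Rightarrow> (nat \<Rightarrow> 'k) set"
  where "tensor_piece F i j = {v. \<forall>b. v b \<noteq> 0 \<longrightarrow> b < rk F i \<and> shift F i b = j}"

definition tensor_diff ::
    "('n::finite, 'k::field) augmented_free_complex \<Rightarrow> nat \<Rightarrow> (nat \<Rightarrow> 'k) \<Rightarrow> nat \<Rightarrow> 'k"
  where "tensor_diff F i v =
    (\<lambda>c. if c < rk F i then \<Sum>b<rk F (Suc i). const_term (differential F i c b) * v b else 0)"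

definition tor_cycles ::
    "('n::finite, 'k::field) augmented_free_complex \<Rightarrow> nat \<Rightarrow> int \<Rightarrow> (nat \<Rightarrow> 'k) set"
  where "tor_cycles F i j =
    {v \<in> tensor_piece F i j. \<forall>i'. i = Suc i' \<longrightarrow> tensor_diff F i' v = (\<lambda>_. 0)}"

definition tor_boundaries ::
    "('n::finite, 'k::field) augmented_free_complex \<Rightarrow> nat \<Rightarrow> int \<Rightarrow> (nat \<Rightarrow> 'k) set"
  where "tor_boundaries F i j = tensor_diff F i ` tensor_piece F (Suc i) j"

abbreviation kdim :: "(nat \<Rightarrow> 'k::field) set \<Rightarrow> nat"
  where "kdim \<equiv> vector_space.dim (\<lambda>c v b. c * v b)"

lemma vector_space_functions: "vector_space (\<lambda>(c::'k::field) (v::nat \<Rightarrow> 'k) b. c * v b)"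
  by unfold_locales (auto simp: fun_eq_iff algebra_simps)

text \<open>For a resolution the boundaries form a subspace of the cycles, and both are finite
  dimensional, so the difference below is the dimension of the quotient
  \<open>Tor\<^sub>i(R/J, k)\<^sub>j = H\<^sub>i(F \<otimes> k)\<^sub>j\<close>.\<close>

definition tor_dim :: "('n::finite, 'k::field) augmented_free_complex \<Rightarrow> nat \<Rightarrow> int \<Rightarrow> nat"
  where "tor_dim F i j = kdim (tor_cycles F i j) - kdim (tor_boundaries F i j)"

text \<open>The graded Betti number \<open>\<beta>\<^sub>i\<^sub>,\<^sub>j(R/J)\<close>, computed from a chosen resolution of \<open>R/J\<close>. For a
  graded ideal \<open>J\<close> a resolution by free modules of finite rank exists, as \<open>R\<close> is Noetherian,
  and the result does not depend on the choice.\<close>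

definition betti_quot :: "nat \<Rightarrow> int \<Rightarrow> ('n::finite, 'k::field) mpoly set \<Rightarrow> nat"
  where "betti_quot i j J = tor_dim (SOME F. graded_free_resolution J F) i j"

end

theory Submission
  imports Defs
begin

text \<open>\<open>Tor\<^sub>n(R/J, k)\<close> is, up to a shift by \<open>n\<close>, the socle of \<open>R/J\<close>. The socle of
  \<open>R/mono(I)\<close> is spanned by monomials, and a monomial lies in \<open>mono(I)\<close> if and only if it lies
  in \<open>I\<close>; so a socle monomial of \<open>R/mono(I)\<close> is a nonzero socle element of \<open>R/I\<close> of the same
  degree.

  The description of \<open>Tor\<^sub>n\<close> is obtained without the Koszul complex, by killing one variable of
  a resolution \<open>F\<close> at a time: since \<open>x\<close> is a nonzerodivisor modulo the variables in \<open>V\<close>, the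
  top homology of \<open>F\<close> modulo \<open>V \<union> {x}\<close> is the \<open>x\<close>-torsion of the top homology of \<open>F\<close>
  modulo \<open>V\<close>. That finite free resolutions exist is proved by Groebner bases and Dickson's
  lemma.\<close>

text \<open>Let \<open>d\<close> be the cardinality of \<open>V\<close>. Multiplication by
  \<open>x\<close> on F/VF is injective with cokernel F/(V,x)F, and the long exact sequence reads
  H_(d+1)(F/V) -> H_(d+1)(F/(V,x)) -> H_d(F/V) -> H_d(F/V), the last map being multiplication by
  \<open>x\<close>. The first group vanishes because homology modulo \<open>d\<close> variables is
  zero above degree \<open>d\<close>; this is what makes the step an isomorphism onto torsion. It
  lowers internal degrees by one, whence the total shift by \<open>n\<close>. A single property
  survives every step unchanged: a nonzero class annihilated by all variables, killed or not. Only
  the existence of such a class in a given degree is compared, so homology modules are never formed: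
  classes are represented by vectors, and equality is congruence modulo \<open>var_ideal V\<close>.
  Betti numbers are read off from a resolution picked by \<open>SOME\<close>. The criterion is
  proved for an arbitrary graded free resolution, and the existence theorem ensures that the picked
  object is one.\<close>

abbreviation lookup :: "('a \<Rightarrow>\<^sub>0 'b::zero) \<Rightarrow> 'a \<Rightarrow> 'b"
  where "lookup \<equiv> Poly_Mapping.lookup"

abbreviation keys :: "('a \<Rightarrow>\<^sub>0 'b::zero) \<Rightarrow> 'a set"
  where "keys \<equiv> Poly_Mapping.keys"

abbreviation single :: "'a \<Rightarrow> 'b \<Rightarrow> 'a \<Rightarrow>\<^sub>0 'b::zero"
  where "single \<equiv> Poly_Mapping.single"

section \<open>Restricting a polynomial to a set of monomials\<close>

text \<open>Serves two purposes: homogeneous parts, and splitting off the monomials divisible by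
  given variables.\<close>

definition restr :: "('a \<Rightarrow> bool) \<Rightarrow> ('a \<Rightarrow>\<^sub>0 'b::zero) \<Rightarrow> 'a \<Rightarrow>\<^sub>0 'b"
  where "restr P p = Poly_Mapping.mapp (\<lambda>m c. c when P m) p"

lemma lookup_restr: "lookup (restr P p) m = (lookup p m when P m)"
  by (auto simp: restr_def lookup_mapp when_def in_keys_iff)

lemma keys_restr: "keys (restr P p) = {m \<in> keys p. P m}"
  by (auto simp: in_keys_iff lookup_restr)

lemma restr_add: "restr P (p + q) = restr P p + restr P (q :: _ \<Rightarrow>\<^sub>0 'b::comm_monoid_add)"
  by (rule poly_mapping_eqI) (simp add: lookup_restr lookup_add when_add_distrib)

lemma restr_diff: "restr P (p - q) = restr P p - restr P (q :: _ \<Rightarrow>\<^sub>0 'b::ab_group_add)"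
  by (rule poly_mapping_eqI) (simp add: lookup_restr lookup_minus when_def)

lemma restr_zero [simp]: "restr P 0 = 0"
  by (rule poly_mapping_eqI) (simp add: lookup_restr)

lemma restr_sum: "restr P (\<Sum>a\<in>A. f a) = (\<Sum>a\<in>A. restr P (f a :: _ \<Rightarrow>\<^sub>0 'b::comm_monoid_add))"
  by (induction A rule: infinite_finite_induct) (simp_all add: restr_add)

lemma restr_split: "restr P p + restr (\<lambda>m. \<not> P m) (p :: _ \<Rightarrow>\<^sub>0 'b::comm_monoid_add) = p"
  by (rule poly_mapping_eqI) (simp add: lookup_restr lookup_add when_def)

lemma restr_id: "(\<And>m. m \<in> keys p \<Longrightarrow> P m) \<Longrightarrow> restr P p = p"
  by (rule poly_mapping_eqI) (auto simp: lookup_restr when_def in_keys_iff)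

lemma restr_none: "(\<And>m. m \<in> keys p \<Longrightarrow> \<not> P m) \<Longrightarrow> restr P p = 0"
  by (rule poly_mapping_eqI) (auto simp: lookup_restr when_def in_keys_iff)

lemma sum_monomials: "(\<Sum>m\<in>keys p. single m (lookup p m :: 'b::comm_monoid_add)) = p"
proof (rule poly_mapping_eqI)
  fix m
  have "lookup (\<Sum>m'\<in>keys p. single m' (lookup p m')) m = (\<Sum>m'\<in>keys p. if m' = m then lookup p m' else 0)"
    by (simp add: lookup_sum lookup_single when_def)
  also have "\<dots> = lookup p m"
    by (simp add: in_keys_iff)
  finally show "lookup (\<Sum>m'\<in>keys p. single m' (lookup p m')) m = lookup p m" .
qed

lemma keys_multD:
  "m \<in> keys (p * q) \<Longrightarrow> \<exists>a\<in>keys p. \<exists>b\<in>keys q. m = a + b"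
  using keys_mult[of p q] by blast

text \<open>In the convolution only the exponent \<open>a\<close> contributes on the left, and
  \<open>a + m = a + b\<close> forces \<open>b = m\<close>. Thus a monomial factor never causes
  cancellation.\<close>

lemma lookup_single_times_add:
  fixes q :: "('n \<Rightarrow>\<^sub>0 nat) \<Rightarrow>\<^sub>0 'k::field"
  shows "lookup (single a c * q) (a + m) = c * lookup q m"
proof -
  have "lookup (single a c * q) (a + m) =
      Sum_any (\<lambda>l. (c * Sum_any (\<lambda>b. lookup q b when a + m = l + b)) when l = a)"
    unfolding lookup_mult by (rule Sum_any.cong) (auto simp: lookup_single when_def)
  then show ?thesis by simp
qed

section \<open>Homogeneous parts\<close>

lemma mdeg_add: "mdeg (a + b) = mdeg a + mdeg b"
  by (simp add: mdeg_def lookup_add sum.distrib)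

lemma mdeg_zero [simp]: "mdeg 0 = 0"
  by (simp add: mdeg_def)

lemma mdeg_single [simp]: "mdeg (single i e) = e"
  by (simp add: mdeg_def lookup_single when_def)

text \<open>Unlike \<open>hom_component\<close>, the degree is an integer, because degrees such as
  \<open>D - shift F i b\<close> can be negative.\<close>

definition hpart :: "int \<Rightarrow> ('n::finite, 'k::field) mpoly \<Rightarrow> ('n, 'k) mpoly"
  where "hpart d = restr (\<lambda>m. int (mdeg m) = d)"

lemma lookup_hpart: "lookup (hpart d p) m = (lookup p m when int (mdeg m) = d)"
  by (simp add: hpart_def lookup_restr)

lemma hpart_diff: "hpart d (p - q) = hpart d p - hpart d q"
  by (simp add: hpart_def restr_diff)

lemma hpart_sum: "hpart d (\<Sum>a\<in>A. f a) = (\<Sum>a\<in>A. hpart d (f a))"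
  by (simp add: hpart_def restr_sum)

lemma keys_hpart: "keys (hpart d p) = {m \<in> keys p. int (mdeg m) = d}"
  by (simp add: hpart_def keys_restr)

lemma homogeneous_hpart: "homogeneous d (hpart d p)"
  by (simp add: homogeneous_def keys_hpart)

lemma hpart_homogeneous: "homogeneous d p \<Longrightarrow> hpart d p = p"
  unfolding hpart_def homogeneous_def by (rule restr_id) auto

lemma hom_component_eq_hpart: "hom_component d p = hpart (int d) p"
proof (rule poly_mapping_eqI)
  fix m
  have "lookup (hom_component d p) m =
      (\<Sum>m' | m' \<in> keys p \<and> mdeg m' = d. if m' = m then lookup p m' else 0)"
    by (simp add: hom_component_def lookup_sum lookup_single when_def)
  also have "\<dots> = lookup (hpart (int d) p) m"
    by (auto simp: lookup_hpart when_def in_keys_iff)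
  finally show "lookup (hom_component d p) m = lookup (hpart (int d) p) m" .
qed

lemma hpart_neg: "d < 0 \<Longrightarrow> hpart d p = 0"
  unfolding hpart_def by (rule restr_none) auto

lemma homogeneous_mult: "homogeneous d p \<Longrightarrow> homogeneous e q \<Longrightarrow> homogeneous (d + e) (p * q)"
  unfolding homogeneous_def by (auto dest!: keys_multD simp: mdeg_add)

text \<open>Split \<open>q\<close> into its degree \<open>d\<close> part and the rest; degrees of
  monomials add, so \<open>p\<close> times the rest has nothing in degree \<open>f\<close>. Keeping
  \<open>f\<close> separate lets the rule match differences of shifts and leaves only
  arithmetic.\<close>

lemma hpart_mult:
  assumes "homogeneous e p" and "f = d + e"
  shows "hpart f (p * q) = p * hpart d q"
proof -
  let ?r = "restr (\<lambda>m. int (mdeg m) \<noteq> d) q"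
  have "p * hpart d q + p * ?r = p * q"
    unfolding hpart_def distrib_left[symmetric] using restr_split[of "\<lambda>m. int (mdeg m) = d" q] by simp
  moreover have "hpart f (p * hpart d q) = p * hpart d q"
    using homogeneous_mult[OF assms(1) homogeneous_hpart] assms(2)
    by (intro hpart_homogeneous) (simp add: add.commute)
  moreover have "hpart f (p * ?r) = 0"
    unfolding hpart_def using assms
    by (intro restr_none) (auto dest!: keys_multD simp: keys_restr mdeg_add homogeneous_def)
  moreover have "hpart f (p * hpart d q + p * ?r) = hpart f (p * hpart d q) + hpart f (p * ?r)"
    by (simp only: hpart_def restr_add)
  ultimately show ?thesis
    by (simp only: add_0_right)
qed

definition indet :: "'n \<Rightarrow> ('n::finite, 'k::field) mpoly"
  where "indet i = single (single i 1) 1"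

lemma homogeneous_indet: "homogeneous 1 (indet i)"
  by (auto simp: homogeneous_def indet_def)

section \<open>The ideal generated by a set of variables\<close>

text \<open>A test on each monomial separately instead of a generating set: stability under
  homogeneous parts and cancellation of variables can be read off from exponents. The extreme cases
  are the zero ideal and the maximal ideal.\<close>

definition var_ideal :: "'n set \<Rightarrow> ('n::finite, 'k::field) mpoly set"
  where "var_ideal V = {p. \<forall>m\<in>keys p. \<exists>i\<in>V. lookup m i \<noteq> 0}"

lemma zero_in_var_ideal [simp]: "0 \<in> var_ideal V"
  by (simp add: var_ideal_def)

lemma add_in_var_ideal: "p \<in> var_ideal V \<Longrightarrow> q \<in> var_ideal V \<Longrightarrow> p + q \<in> var_ideal V"
  using keys_add[of p q] by (auto simp: var_ideal_def)

lemma uminus_in_var_ideal: "p \<in> var_ideal V \<Longrightarrow> - p \<in> var_ideal V"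
  by (auto simp: var_ideal_def in_keys_iff)

lemma diff_in_var_ideal: "p \<in> var_ideal V \<Longrightarrow> q \<in> var_ideal V \<Longrightarrow> p - q \<in> var_ideal V"
  using add_in_var_ideal[OF _ uminus_in_var_ideal, of p V q] by simp

lemma mult_in_var_ideal: "p \<in> var_ideal V \<Longrightarrow> q * p \<in> var_ideal V"
  by (auto simp: var_ideal_def lookup_add dest!: keys_multD) blast

lemma sum_in_var_ideal: "(\<And>a. a \<in> A \<Longrightarrow> f a \<in> var_ideal V) \<Longrightarrow> (\<Sum>a\<in>A. f a) \<in> var_ideal V"
  by (induction A rule: infinite_finite_induct) (auto intro: add_in_var_ideal)

lemma hpart_in_var_ideal: "p \<in> var_ideal V \<Longrightarrow> hpart d p \<in> var_ideal V"
  by (auto simp: var_ideal_def keys_hpart)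

lemma var_ideal_mono: "V \<subseteq> W \<Longrightarrow> p \<in> var_ideal V \<Longrightarrow> p \<in> var_ideal W"
  by (force simp: var_ideal_def)

lemma var_ideal_empty [simp]: "p \<in> var_ideal {} \<longleftrightarrow> p = 0"
  by (auto simp: var_ideal_def in_keys_iff intro!: poly_mapping_eqI)

lemma var_ideal_UNIV: "p \<in> var_ideal UNIV \<longleftrightarrow> lookup p 0 = 0"
proof -
  have "(\<exists>i. lookup m i \<noteq> 0) \<longleftrightarrow> m \<noteq> 0" for m :: "'a \<Rightarrow>\<^sub>0 nat"
    by (auto intro: poly_mapping_eqI)
  then show ?thesis by (auto simp: var_ideal_def in_keys_iff)
qed

lemma indet_mult_in_var_ideal: "i \<in> V \<Longrightarrow> indet i * p \<in> var_ideal V"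
  unfolding var_ideal_def indet_def
  by (auto dest!: keys_multD simp: lookup_add intro!: bexI[of _ i])

text \<open>The nonzerodivisor property: raising the exponent of \<open>i\<close> leaves the
  exponents of the variables in \<open>V\<close> unchanged.\<close>

lemma indet_mult_in_var_ideal_iff:
  assumes "i \<notin> V"
  shows "indet i * p \<in> var_ideal V \<longleftrightarrow> p \<in> var_ideal V"
proof
  assume *: "indet i * p \<in> var_ideal V"
  show "p \<in> var_ideal V"
    unfolding var_ideal_def
  proof safe
    fix m assume "m \<in> keys p"
    then have "single i 1 + m \<in> keys (indet i * p)"
      by (simp add: in_keys_iff indet_def lookup_single_times_add)
    with * obtain j where "j \<in> V" "lookup (single i 1 + m) j \<noteq> 0"
      by (auto simp: var_ideal_def)
    with assms show "\<exists>j\<in>V. lookup m j \<noteq> 0"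
      by (auto simp: lookup_add lookup_single when_def split: if_splits)
  qed
qed (rule mult_in_var_ideal)

lemma exponent_decomp:
  fixes m :: "'n \<Rightarrow>\<^sub>0 nat"
  assumes "\<And>i. lookup a i \<le> lookup m i"
  shows "a + (m - a) = m"
  using assms by (intro poly_mapping_eqI) (simp add: lookup_add lookup_minus)

lemma indet_dvd:
  assumes "\<And>m. m \<in> keys p \<Longrightarrow> lookup m i \<noteq> 0"
  obtains q where "p = indet i * q"
proof
  show "p = indet i * (\<Sum>m\<in>keys p. single (m - single i 1) (lookup p m))"
  proof -
    have "indet i * single (m - single i 1) (lookup p m) = single m (lookup p m)"
      if "m \<in> keys p" for m
    proof -
      have "single i 1 + (m - single i 1) = m"
        using assms[OF that] by (intro exponent_decomp) (auto simp: lookup_single when_def Suc_le_eq)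
      then show ?thesis by (simp add: indet_def mult_single)
    qed
    then show ?thesis
      using sum_monomials[of p] by (simp add: sum_distrib_left)
  qed
qed

text \<open>The monomials divisible by a variable of \<open>V\<close> make up \<open>r\<close>; each
  remaining one must be divisible by the variable \<open>i\<close>.\<close>

lemma var_ideal_insertE:
  assumes "p \<in> var_ideal (insert i V)"
  obtains q r where "p = indet i * q + r" and "r \<in> var_ideal V"
proof -
  let ?P = "\<lambda>m. \<exists>j\<in>V. lookup m j \<noteq> 0"
  have "lookup m i \<noteq> 0" if "m \<in> keys (restr (\<lambda>m. \<not> ?P m) p)" for m
    using that assms by (auto simp: keys_restr var_ideal_def)
  then obtain q where "restr (\<lambda>m. \<not> ?P m) p = indet i * q"
    using indet_dvd by blast
  moreover have "restr ?P p \<in> var_ideal V"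
    by (auto simp: var_ideal_def keys_restr)
  ultimately show thesis
    using that[of q "restr ?P p"] restr_split[of ?P p] by (simp add: add.commute)
qed

section \<open>Ideals of the polynomial ring\<close>

lemma ideal_mpoly_ring:
  assumes "ideal J (mpoly_ring :: ('n::finite, 'k::field) mpoly ring)"
  shows "0 \<in> J" "p \<in> J \<Longrightarrow> q \<in> J \<Longrightarrow> p + q \<in> J" "p \<in> J \<Longrightarrow> q * p \<in> J"
    "p \<in> J \<Longrightarrow> - p \<in> J" "p \<in> J \<Longrightarrow> q \<in> J \<Longrightarrow> p - q \<in> J"
proof -
  interpret ideal J "mpoly_ring :: ('n, 'k) mpoly ring" by fact
  show "0 \<in> J" using additive_subgroup.zero_closed[OF is_additive_subgroup] by (simp add: ring_of_type_algebra_def)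
  show add: "p + q \<in> J" if "p \<in> J" "q \<in> J" for p q
    using additive_subgroup.a_closed[OF is_additive_subgroup that] by (simp add: ring_of_type_algebra_def)
  show mult: "q * p \<in> J" if "p \<in> J" for p q
    using I_l_closed[OF that, of q] by (simp add: ring_of_type_algebra_def)
  show uminus: "- p \<in> J" if "p \<in> J" for p
    using mult[OF that, of "- 1"] by simp
  show "p - q \<in> J" if "p \<in> J" "q \<in> J" for p q
    using add[OF that(1) uminus[OF that(2)]] by simp
qed

lemma graded_ideal_hpart:
  assumes "graded_ideal J" and "p \<in> J"
  shows "hpart d p \<in> J"
proof (cases "d < 0")
  case True
  with assms show ?thesis by (simp add: graded_ideal_def hpart_neg ideal_mpoly_ring(1))
next
  case False
  with assms have "hpart (int (nat d)) p \<in> J"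
    unfolding hom_component_eq_hpart[symmetric] by (simp add: graded_ideal_def)
  with False show ?thesis by simp
qed

section \<open>The maps of a free complex\<close>

lemma diff_map_diff: "diff_map F i (\<lambda>b. v b - w b) c = diff_map F i v c - diff_map F i w c"
  by (simp add: diff_map_def right_diff_distrib sum_subtractf)

lemma diff_map_mult: "diff_map F i (\<lambda>b. p * v b) c = p * diff_map F i v c"
  by (simp add: diff_map_def sum_distrib_left mult.left_commute)

lemma diff_map_cong:
  "(\<And>b. b < rk F (Suc i) \<Longrightarrow> v b = w b) \<Longrightarrow> diff_map F i v c = diff_map F i w c"
  by (simp add: diff_map_def)

lemma diff_map_in_var_ideal:
  "(\<And>b. b < rk F (Suc i) \<Longrightarrow> v b \<in> var_ideal V) \<Longrightarrow> diff_map F i v c \<in> var_ideal V"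
  unfolding diff_map_def by (intro sum_in_var_ideal mult_in_var_ideal) auto

text \<open>The degree \<open>D\<close> component for the grading of the shifted module: the
  \<open>b\<close>-th basis element already contributes \<open>shift F i b\<close>.\<close>

definition hpart_vec ::
    "('n::finite, 'k::field) augmented_free_complex \<Rightarrow> nat \<Rightarrow> int \<Rightarrow> (nat \<Rightarrow> ('n, 'k) mpoly) \<Rightarrow>
      nat \<Rightarrow> ('n, 'k) mpoly"
  where "hpart_vec F i D v b = hpart (D - shift F i b) (v b)"

definition hom_vec ::
    "('n::finite, 'k::field) augmented_free_complex \<Rightarrow> nat \<Rightarrow> int \<Rightarrow> (nat \<Rightarrow> ('n, 'k) mpoly) \<Rightarrow> bool"
  where "hom_vec F i D v \<longleftrightarrow> (\<forall>b<rk F i. homogeneous (D - shift F i b) (v b))"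

lemma hom_vec_hpart_vec: "hom_vec F i D (hpart_vec F i D v)"
  by (simp add: hom_vec_def hpart_vec_def homogeneous_hpart)

lemma hpart_vec_hom_vec: "hom_vec F i D v \<Longrightarrow> b < rk F i \<Longrightarrow> hpart_vec F i D v b = v b"
  by (simp add: hom_vec_def hpart_vec_def hpart_homogeneous)

locale free_resolution =
  fixes J :: "('n::finite, 'k::field) mpoly set"
    and F :: "('n, 'k) augmented_free_complex"
  assumes resolution: "graded_free_resolution J F"
    and graded: "graded_ideal J"
begin

lemmas J_ideal = ideal_mpoly_ring[OF graded[unfolded graded_ideal_def, THEN conjunct1]]

lemma exact:
  "(\<forall>c<rk F i. diff_map F i v c = 0) \<longleftrightarrow> (\<exists>w. \<forall>b<rk F (Suc i). v b = diff_map F (Suc i) w b)"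
  using resolution unfolding graded_free_resolution_def by blast

lemma diff_map_diff_map: "c < rk F i \<Longrightarrow> diff_map F i (diff_map F (Suc i) w) c = 0"
  using exact[of i "diff_map F (Suc i) w"] by blast

lemma aug_map_in_iff: "aug_map F v \<in> J \<longleftrightarrow> (\<exists>w. \<forall>c<rk F 0. v c = diff_map F 0 w c)"
  using resolution unfolding graded_free_resolution_def by blast

lemma aug_map_surj: "\<exists>v. p - aug_map F v \<in> J"
  using resolution unfolding graded_free_resolution_def by blast

lemma homogeneous_differential:
  "c < rk F i \<Longrightarrow> b < rk F (Suc i) \<Longrightarrow>
    homogeneous (shift F (Suc i) b - shift F i c) (differential F i c b)"
  using resolution unfolding graded_free_resolution_def by blast

lemma homogeneous_augmentation: "b < rk F 0 \<Longrightarrow> homogeneous (shift F 0 b) (augmentation F b)"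
  using resolution unfolding graded_free_resolution_def by blast

text \<open>The differential has degree 0: the degree of an entry plus
  \<open>D - shift F (Suc i) b\<close> is \<open>D - shift F i c\<close>, whatever \<open>b\<close>
  is.\<close>

lemma diff_map_hpart_vec:
  assumes "c < rk F i"
  shows "diff_map F i (hpart_vec F (Suc i) D v) c = hpart (D - shift F i c) (diff_map F i v c)"
proof -
  have "hpart (D - shift F i c) (differential F i c b * v b) =
      differential F i c b * hpart_vec F (Suc i) D v b" if "b < rk F (Suc i)" for b
    unfolding hpart_vec_def by (rule hpart_mult[OF homogeneous_differential[OF assms that]]) simp
  then show ?thesis
    by (simp add: diff_map_def hpart_sum)
qed

lemma aug_map_hpart_vec: "aug_map F (hpart_vec F 0 D v) = hpart D (aug_map F v)"
proof -
  have "hpart D (augmentation F b * v b) = augmentation F b * hpart_vec F 0 D v b" if "b < rk F 0" for b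
    unfolding hpart_vec_def by (rule hpart_mult[OF homogeneous_augmentation[OF that]]) simp
  then show ?thesis
    by (simp add: aug_map_def hpart_sum)
qed

lemma aug_map_mult: "aug_map F (\<lambda>b. p * v b) = p * aug_map F v"
  by (simp add: aug_map_def sum_distrib_left mult.left_commute)

section \<open>Homology modulo a set of variables\<close>

text \<open>\<open>diff_map F i'\<close> leaves the module with index \<open>Suc i'\<close>, so for
  \<open>i = 0\<close> the condition is void. The augmentation is left out on purpose: homology in
  degree 0 is then R/J for empty \<open>V\<close>.\<close>

definition cycle_mod :: "'n set \<Rightarrow> nat \<Rightarrow> (nat \<Rightarrow> ('n, 'k) mpoly) \<Rightarrow> bool"
  where "cycle_mod V i y \<longleftrightarrow>
    (\<forall>i'. i = Suc i' \<longrightarrow> (\<forall>c<rk F i'. diff_map F i' y c \<in> var_ideal V))"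

definition bdry_mod :: "'n set \<Rightarrow> nat \<Rightarrow> (nat \<Rightarrow> ('n, 'k) mpoly) \<Rightarrow> bool"
  where "bdry_mod V i y \<longleftrightarrow> (\<exists>w. \<forall>b<rk F i. y b - diff_map F i w b \<in> var_ideal V)"

text \<open>\<open>linked x V i z y\<close> says that the connecting homomorphism of multiplication by \<open>x\<close> on \<open>F\<close>
  modulo \<open>V\<close> maps the class of \<open>z\<close> to the class of \<open>y\<close>.\<close>

definition linked :: "'n \<Rightarrow> 'n set \<Rightarrow> nat \<Rightarrow> (nat \<Rightarrow> ('n, 'k) mpoly) \<Rightarrow> (nat \<Rightarrow> ('n, 'k) mpoly) \<Rightarrow> bool"
  where "linked x V i z y \<longleftrightarrow> (\<forall>c<rk F i. diff_map F i z c - indet x * y c \<in> var_ideal V)"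

section \<open>The connecting homomorphism of multiplication by a variable\<close>

lemma linked_mult: "linked x V i z y \<Longrightarrow> linked x V i (\<lambda>b. p * z b) (\<lambda>b. p * y b)"
proof -
  have "diff_map F i (\<lambda>b. p * z b) c - indet x * (p * y c) = p * (diff_map F i z c - indet x * y c)" for c
    by (simp add: diff_map_mult algebra_simps)
  then show "linked x V i z y \<Longrightarrow> ?thesis"
    by (simp add: linked_def mult_in_var_ideal)
qed

text \<open>Apply the differential to the linking congruence: its square is zero, so
  \<open>x\<close> times the differential of \<open>y\<close> lies in \<open>var_ideal V\<close>,
  and \<open>x\<close> can be cancelled.\<close>

lemma linked_cycle_mod_right:
  assumes "x \<notin> V" and "linked x V i z y"
  shows "cycle_mod V i y"
  unfolding cycle_mod_def
proof (intro allI impI)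
  fix i' c assume i: "i = Suc i'" and c: "c < rk F i'"
  have "diff_map F i' (\<lambda>b. diff_map F i z b - indet x * y b) c \<in> var_ideal V"
    using assms(2) by (intro diff_map_in_var_ideal) (simp add: linked_def i)
  moreover have "diff_map F i' (\<lambda>b. diff_map F i z b - indet x * y b) c = - (indet x * diff_map F i' y c)"
    using diff_map_diff_map[OF c, of z] by (simp add: diff_map_diff diff_map_mult i)
  ultimately have "indet x * diff_map F i' y c \<in> var_ideal V"
    using uminus_in_var_ideal by fastforce
  with assms(1) show "diff_map F i' y c \<in> var_ideal V"
    by (simp add: indet_mult_in_var_ideal_iff)
qed

lemma linked_cycle_mod_left:
  assumes "linked x V i z y"
  shows "cycle_mod (insert x V) (Suc i) z"
  unfolding cycle_mod_def
proof (intro allI impI)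
  fix i' c assume "Suc i = Suc i'" and "c < rk F i'"
  then have "diff_map F i z c - indet x * y c \<in> var_ideal (insert x V)"
    using assms var_ideal_mono[of V "insert x V"] by (auto simp: linked_def)
  from add_in_var_ideal[OF this indet_mult_in_var_ideal[of x _ "y c"]]
  show "diff_map F i' z c \<in> var_ideal (insert x V)"
    using \<open>Suc i = Suc i'\<close> by simp
qed

lemma var_ideal_insert_vecE:
  assumes "\<And>c. c < n \<Longrightarrow> v c \<in> var_ideal (insert x V)"
  obtains y where "\<forall>c<n. v c - indet x * y c \<in> var_ideal V"
proof -
  have "\<exists>q. c < n \<longrightarrow> v c - indet x * q \<in> var_ideal V" for c
    using assms var_ideal_insertE by (metis add_diff_cancel_left')
  then show thesis using that by metis
qed

lemma cycle_mod_linkedE: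
  assumes "cycle_mod (insert x V) (Suc i) z"
  obtains y where "linked x V i z y"
proof -
  have "diff_map F i z c \<in> var_ideal (insert x V)" if "c < rk F i" for c
    using assms that by (auto simp: cycle_mod_def)
  then obtain y where "\<forall>c<rk F i. diff_map F i z c - indet x * y c \<in> var_ideal V"
    by (rule var_ideal_insert_vecE)
  then show thesis using that[of y] by (simp add: linked_def)
qed

text \<open>Injectivity of the connecting homomorphism. If \<open>y\<close> bounds \<open>w\<close>,
  then \<open>z - x w\<close> is a cycle modulo \<open>V\<close>, hence a boundary there by
  acyclicity, and the term \<open>x w\<close> disappears modulo \<open>x\<close>.\<close>

lemma linked_bdry_mod_left:
  assumes "linked x V i z y" and "bdry_mod V i y"
    and acyclic: "\<And>u. cycle_mod V (Suc i) u \<Longrightarrow> bdry_mod V (Suc i) u"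
  shows "bdry_mod (insert x V) (Suc i) z"
proof -
  obtain w where w: "\<And>b. b < rk F i \<Longrightarrow> y b - diff_map F i w b \<in> var_ideal V"
    using assms(2) by (auto simp: bdry_mod_def)
  let ?u = "\<lambda>b. z b - indet x * w b"
  have "diff_map F i ?u c \<in> var_ideal V" if "c < rk F i" for c
  proof -
    have "diff_map F i ?u c =
        (diff_map F i z c - indet x * y c) + indet x * (y c - diff_map F i w c)"
      by (simp add: diff_map_diff diff_map_mult algebra_simps)
    then show ?thesis
      using assms(1) w[OF that] that by (simp add: linked_def add_in_var_ideal mult_in_var_ideal)
  qed
  then have "bdry_mod V (Suc i) ?u"
    by (intro acyclic) (simp add: cycle_mod_def)
  then obtain w' where w': "\<And>b. b < rk F (Suc i) \<Longrightarrow> ?u b - diff_map F (Suc i) w' b \<in> var_ideal V"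
    by (auto simp: bdry_mod_def)
  have "z b - diff_map F (Suc i) w' b \<in> var_ideal (insert x V)" if "b < rk F (Suc i)" for b
  proof -
    have "z b - diff_map F (Suc i) w' b = (?u b - diff_map F (Suc i) w' b) + indet x * w b"
      by simp
    also have "\<dots> \<in> var_ideal (insert x V)"
      by (intro add_in_var_ideal indet_mult_in_var_ideal var_ideal_mono[OF _ w'[OF that]]) auto
    finally show ?thesis .
  qed
  then show ?thesis by (auto simp: bdry_mod_def)
qed

text \<open>The connecting homomorphism is well defined. Write \<open>z\<close> as a boundary plus
  \<open>x w'\<close> modulo \<open>V\<close>; applying the differential gives \<open>x y\<close>
  congruent to \<open>x\<close> times the differential of \<open>w'\<close>, and \<open>x\<close>
  cancels.\<close>

lemma linked_bdry_mod_right: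
  assumes "x \<notin> V" and "linked x V i z y" and "bdry_mod (insert x V) (Suc i) z"
  shows "bdry_mod V i y"
proof -
  obtain w where "\<And>b. b < rk F (Suc i) \<Longrightarrow> z b - diff_map F (Suc i) w b \<in> var_ideal (insert x V)"
    using assms(3) by (auto simp: bdry_mod_def)
  then obtain w' where
    w': "\<forall>b<rk F (Suc i). z b - diff_map F (Suc i) w b - indet x * w' b \<in> var_ideal V"
    by (rule var_ideal_insert_vecE)
  have "y c - diff_map F i w' c \<in> var_ideal V" if c: "c < rk F i" for c
  proof -
    have "diff_map F i (\<lambda>b. z b - diff_map F (Suc i) w b - indet x * w' b) c \<in> var_ideal V"
      using w' by (intro diff_map_in_var_ideal) blast
    then have "diff_map F i z c - indet x * diff_map F i w' c \<in> var_ideal V"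
      by (simp add: diff_map_diff diff_map_mult diff_map_diff_map[OF c])
    moreover have "diff_map F i z c - indet x * y c \<in> var_ideal V"
      using assms(2) c by (simp add: linked_def)
    ultimately have "indet x * (y c - diff_map F i w' c) \<in> var_ideal V"
      using diff_in_var_ideal by (fastforce simp: algebra_simps)
    with assms(1) show ?thesis by (simp add: indet_mult_in_var_ideal_iff)
  qed
  then show ?thesis by (auto simp: bdry_mod_def)
qed

text \<open>Induction by the long exact sequence: modulo one more variable, homology in degree
  \<open>i\<close> sits between homology in degrees \<open>i\<close> and \<open>i - 1\<close> modulo
  \<open>V\<close>, both above the cardinality of \<open>V\<close>.\<close>

lemma acyclic:
  assumes "card V < i" and "cycle_mod V i z"
  shows "bdry_mod V i z"
  using finite[of V] assms
proof (induction V arbitrary: i z rule: finite_induct)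
  case empty
  then obtain i' where i: "i = Suc i'" by (cases i) auto
  with empty have "\<forall>c<rk F i'. diff_map F i' z c = 0"
    by (simp add: cycle_mod_def)
  then show ?case
    unfolding exact by (simp add: bdry_mod_def i)
next
  case (insert x V)
  then obtain i' where i: "i = Suc i'" and i': "card V < i'" by (cases i) auto
  obtain y where y: "linked x V i' z y"
    using insert.prems i by (blast elim: cycle_mod_linkedE)
  then have "bdry_mod V i' y"
    using insert.IH[OF i'] linked_cycle_mod_right[OF insert.hyps(2)] by blast
  with y show ?case
    unfolding i using insert.IH[of "Suc i'"] i' by (intro linked_bdry_mod_left) auto
qed

lemma linked_bdry_mod_iff:
  assumes "x \<notin> V" and "linked x V (card V) z y"
  shows "bdry_mod (insert x V) (Suc (card V)) z \<longleftrightarrow> bdry_mod V (card V) y"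
  using linked_bdry_mod_left[OF assms(2) _ acyclic] linked_bdry_mod_right[OF assms] by auto

text \<open>The degree is normalised so that \<open>D\<close> does not change when variables are added to \<open>V\<close>: for
  \<open>V = {}\<close> these are the socle elements of \<open>R/J\<close> of degree \<open>D\<close>, and for \<open>V = UNIV\<close>, where
  the condition on \<open>l\<close> is void, the nonzero classes of \<open>Tor\<^sub>n\<close> of degree \<open>D + n\<close>.\<close>

definition socle_class :: "'n set \<Rightarrow> int \<Rightarrow> (nat \<Rightarrow> ('n, 'k) mpoly) \<Rightarrow> bool"
  where "socle_class V D y \<longleftrightarrow>
    hom_vec F (card V) (D + int (card V)) y \<and> cycle_mod V (card V) y \<and> \<not> bdry_mod V (card V) y \<and>
    (\<forall>l. bdry_mod V (card V) (\<lambda>b. indet l * y b))"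

text \<open>Linking is compatible with multiplication by every variable, so annihilation of
  \<open>z\<close> and of \<open>y\<close> is tested by the same boundary equivalence.\<close>

lemma linked_socle_class:
  assumes "x \<notin> V" and link: "linked x V (card V) z y"
    and "hom_vec F (card V) (D + int (card V)) y"
    and "hom_vec F (Suc (card V)) (D + int (Suc (card V))) z"
  shows "socle_class (insert x V) D z \<longleftrightarrow> socle_class V D y"
  using assms linked_bdry_mod_iff[OF assms(1) link]
    linked_bdry_mod_iff[OF assms(1) linked_mult[OF link]]
    linked_cycle_mod_left[OF link] linked_cycle_mod_right[OF assms(1) link]
  by (simp add: socle_class_def)

lemma ex_socle_class_insert:
  assumes x: "x \<notin> V"
  shows "(\<exists>z. socle_class (insert x V) D z) \<longleftrightarrow> (\<exists>y. socle_class V D y)"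
proof
  let ?k = "card V"
  \<comment> \<open>The connecting homomorphism divides by \<open>x\<close>, so \<open>z\<close> has
    one degree more than \<open>y\<close>; the normalisation of \<open>D\<close> absorbs
    this.\<close>
  have deg: "D + int (Suc ?k) - s = (D + int ?k - s) + 1" for s by simp
  {
    assume "\<exists>z. socle_class (insert x V) D z"
    then obtain z where z: "socle_class (insert x V) D z" ..
    then have hz: "hom_vec F (Suc ?k) (D + int (Suc ?k)) z"
      and "cycle_mod (insert x V) (Suc ?k) z"
      using x by (simp_all add: socle_class_def)
    then obtain y where y: "linked x V ?k z y"
      by (blast elim: cycle_mod_linkedE)
    \<comment> \<open>The quotient \<open>y\<close> may have mixed degrees. As \<open>z\<close> is
      homogeneous and \<open>var_ideal V\<close> contains homogeneous parts of its elements, the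
      component in the right degree is still linked to \<open>z\<close>.\<close>
    let ?y = "hpart_vec F ?k (D + int ?k) y"
    have "diff_map F ?k z c - indet x * ?y c \<in> var_ideal V" if c: "c < rk F ?k" for c
    proof -
      have "hpart (D + int (Suc ?k) - shift F ?k c) (diff_map F ?k z c) = diff_map F ?k z c"
        unfolding diff_map_hpart_vec[OF c, symmetric]
        by (rule diff_map_cong) (rule hpart_vec_hom_vec[OF hz])
      moreover have "hpart (D + int (Suc ?k) - shift F ?k c) (indet x * y c) = indet x * ?y c"
        unfolding hpart_vec_def by (rule hpart_mult[OF homogeneous_indet deg])
      moreover have "hpart (D + int (Suc ?k) - shift F ?k c) (diff_map F ?k z c - indet x * y c) \<in> var_ideal V"
        using y c by (intro hpart_in_var_ideal) (simp add: linked_def)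
      ultimately show ?thesis
        by (simp only: hpart_diff)
    qed
    then have "linked x V ?k z ?y" by (simp add: linked_def)
    from linked_socle_class[OF x this hom_vec_hpart_vec hz] z
    show "\<exists>y. socle_class V D y" by blast
  next
    assume "\<exists>y. socle_class V D y"
    then obtain y where y: "socle_class V D y" ..
    then have hy: "hom_vec F ?k (D + int ?k) y" and "bdry_mod V ?k (\<lambda>b. indet x * y b)"
      by (auto simp: socle_class_def)
    \<comment> \<open>Annihilation of the class of \<open>y\<close> by \<open>x\<close> is used
      here: \<open>x y\<close> bounds some \<open>z\<close>, which is the required preimage.\<close>
    then obtain z where z: "\<And>b. b < rk F ?k \<Longrightarrow> indet x * y b - diff_map F ?k z b \<in> var_ideal V"
      by (auto simp: bdry_mod_def)
    let ?z = "hpart_vec F (Suc ?k) (D + int (Suc ?k)) z"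
    have "diff_map F ?k ?z c - indet x * y c \<in> var_ideal V" if c: "c < rk F ?k" for c
    proof -
      have "hpart (D + int (Suc ?k) - shift F ?k c) (indet x * y c) = indet x * hpart_vec F ?k (D + int ?k) y c"
        unfolding hpart_vec_def by (rule hpart_mult[OF homogeneous_indet deg])
      then have "diff_map F ?k ?z c - indet x * y c =
          - hpart (D + int (Suc ?k) - shift F ?k c) (indet x * y c - diff_map F ?k z c)"
        using hpart_vec_hom_vec[OF hy c] by (simp add: diff_map_hpart_vec[OF c] hpart_diff)
      then show ?thesis
        using z[OF c] by (simp only: uminus_in_var_ideal hpart_in_var_ideal)
    qed
    then have "linked x V ?k ?z y" by (simp add: linked_def)
    from linked_socle_class[OF x this hy hom_vec_hpart_vec] y
    show "\<exists>z. socle_class (insert x V) D z" by blast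
  }
qed

text \<open>Modulo no variables a boundary is an honest image, so exactness at the module with index
  0 identifies classes with R/J through \<open>aug_map\<close>. Conversely, lift \<open>u\<close>
  and take the degree \<open>D\<close> component; the error stays in \<open>J\<close> because
  \<open>J\<close> is graded.\<close>

lemma ex_socle_class_empty:
  "(\<exists>y. socle_class {} D y) \<longleftrightarrow>
    (\<exists>u. homogeneous D u \<and> u \<notin> J \<and> (\<forall>l. indet l * u \<in> J))"
proof
  have socle: "socle_class {} D y \<longleftrightarrow> hom_vec F 0 D y \<and> aug_map F y \<notin> J \<and> (\<forall>l. indet l * aug_map F y \<in> J)" for y
    by (simp add: socle_class_def bdry_mod_def cycle_mod_def aug_map_in_iff flip: aug_map_mult)
  {
    assume "\<exists>y. socle_class {} D y"
    then obtain y where y: "socle_class {} D y" ..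
    then have hy: "hom_vec F 0 D y" by (simp add: socle)
    have "aug_map F y = aug_map F (hpart_vec F 0 D y)"
      unfolding aug_map_def using hpart_vec_hom_vec[OF hy] by simp
    then have "homogeneous D (aug_map F y)"
      by (metis aug_map_hpart_vec homogeneous_hpart)
    with y show "\<exists>u. homogeneous D u \<and> u \<notin> J \<and> (\<forall>l. indet l * u \<in> J)"
      unfolding socle by blast
  next
    assume "\<exists>u. homogeneous D u \<and> u \<notin> J \<and> (\<forall>l. indet l * u \<in> J)"
    then obtain u where u: "homogeneous D u" "u \<notin> J" "\<And>l. indet l * u \<in> J" by blast
    obtain v where "u - aug_map F v \<in> J" using aug_map_surj by blast
    then have "hpart D (u - aug_map F v) \<in> J"
      by (rule graded_ideal_hpart[OF graded])
    moreover have "hpart D (u - aug_map F v) = u - aug_map F (hpart_vec F 0 D v)"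
      using hpart_homogeneous[OF u(1)] by (simp add: aug_map_hpart_vec hpart_diff)
    ultimately have *: "u - aug_map F (hpart_vec F 0 D v) \<in> J" by simp
    have "aug_map F (hpart_vec F 0 D v) \<notin> J"
      using J_ideal(2)[OF *, of "aug_map F (hpart_vec F 0 D v)"] u(2) by auto
    moreover have "indet l * aug_map F (hpart_vec F 0 D v) \<in> J" for l
      using J_ideal(5)[OF u(3)[of l] J_ideal(3)[OF *, of "indet l"]] by (simp add: algebra_simps)
    ultimately show "\<exists>y. socle_class {} D y"
      using hom_vec_hpart_vec[of F 0 D v] unfolding socle by blast
  }
qed

text \<open>The right-hand side is independent of \<open>V\<close>; taking \<open>V = UNIV\<close>
  transports the socle to the top \<open>Tor\<close>.\<close>

lemma ex_socle_class:
  "(\<exists>y. socle_class V D y) \<longleftrightarrow> (\<exists>u. homogeneous D u \<and> u \<notin> J \<and> (\<forall>l. indet l * u \<in> J))"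
  using finite[of V]
  by (induction V rule: finite_induct) (simp_all add: ex_socle_class_empty ex_socle_class_insert)

end

lemma sum_apply: "(\<Sum>a\<in>A. f a) b = (\<Sum>a\<in>A. f a b)"
  by (induction A rule: infinite_finite_induct) simp_all

section \<open>\<open>Tor\<close> and socle classes\<close>

interpretation fun_space: vector_space "\<lambda>(c::'k::field) (v::nat \<Rightarrow> 'k) b. c * v b"
  by (rule vector_space_functions)

text \<open>Subtraction truncates, so a strict inequality of dimensions is needed: a vector outside
  the subspace \<open>B\<close> enlarges a basis of \<open>B\<close> to an independent set in the
  span of a basis of \<open>C\<close>. The finite set \<open>T\<close> keeps these cardinalities
  finite.\<close>

lemma kdim_diff_neq_0_iff:
  fixes B C :: "(nat \<Rightarrow> 'k::field) set"
  assumes "B \<subseteq> C" and "fun_space.subspace B" and "finite T" and "C \<subseteq> fun_space.span T"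
  shows "kdim C - kdim B \<noteq> 0 \<longleftrightarrow> (\<exists>v\<in>C. v \<notin> B)"
proof
  assume "kdim C - kdim B \<noteq> 0"
  then have "C \<noteq> B" by auto
  with assms(1) show "\<exists>v\<in>C. v \<notin> B" by blast
next
  assume "\<exists>v\<in>C. v \<notin> B"
  then obtain v where v: "v \<in> C" "v \<notin> B" ..
  obtain b where b: "b \<subseteq> B" "fun_space.independent b" "B \<subseteq> fun_space.span b" "card b = kdim B"
    by (rule fun_space.basis_exists)
  obtain c where c: "c \<subseteq> C" "fun_space.independent c" "C \<subseteq> fun_space.span c" "card c = kdim C"
    by (rule fun_space.basis_exists)
  have "finite c"
    using fun_space.independent_span_bound[OF assms(3) c(2)] c(1) assms(4) by blast
  have "fun_space.span b = B"
    using fun_space.span_subspace[OF b(1,3) assms(2)] .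
  with v b(2) have "fun_space.independent (insert v b)"
    by (intro fun_space.independent_insertI) auto
  moreover have "insert v b \<subseteq> fun_space.span c"
    using b(1) c(3) v(1) assms(1) by blast
  ultimately have *: "finite (insert v b) \<and> card (insert v b) \<le> card c"
    by (rule fun_space.independent_span_bound[OF \<open>finite c\<close>])
  have "v \<notin> b" using b(1) v(2) by blast
  moreover have "finite b" using * by simp
  ultimately have "card (insert v b) = Suc (card b)" by simp
  with * b(4) c(4) show "kdim C - kdim B \<noteq> 0" by simp
qed

text \<open>Modulo the maximal ideal \<open>var_ideal UNIV\<close>, \<open>p\<close> may be replaced
  by its constant term.\<close>

lemma const_term_mult: "const_term (p * q) = const_term p * const_term q"
proof -
  let ?c = "const_term p"
  have "p - single 0 ?c \<in> var_ideal UNIV"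
    by (simp add: var_ideal_UNIV const_term_def lookup_minus)
  then have "q * (p - single 0 ?c) \<in> var_ideal UNIV"
    by (rule mult_in_var_ideal)
  then have "const_term (p * q) = lookup (single 0 ?c * q) 0"
    by (simp add: var_ideal_UNIV algebra_simps lookup_minus const_term_def)
  also have "\<dots> = ?c * const_term q"
    using lookup_single_times_add[of 0 ?c q 0] by (simp add: const_term_def)
  finally show ?thesis .
qed

lemma const_term_sum: "const_term (\<Sum>a\<in>A. f a) = (\<Sum>a\<in>A. const_term (f a))"
  by (simp add: const_term_def lookup_sum)

lemma const_term_diff: "const_term (p - q) = const_term p - const_term q"
  by (simp add: const_term_def lookup_minus)

lemma const_term_single_0 [simp]: "const_term (single 0 c) = c"
  by (simp add: const_term_def)

lemma const_term_homogeneous: "homogeneous d p \<Longrightarrow> const_term p \<noteq> 0 \<Longrightarrow> d = 0"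
  by (force simp: homogeneous_def const_term_def in_keys_iff)

lemma const_term_diff_map:
  "const_term (diff_map F i y c) = (\<Sum>b<rk F (Suc i). const_term (differential F i c b) * const_term (y b))"
  by (simp add: diff_map_def const_term_sum const_term_mult)

text \<open>Tensoring with the residue field is reduction modulo all variables, computed on any
  polynomial lift \<open>y\<close> of \<open>v\<close>.\<close>

lemma tensor_diff_eq:
  assumes "\<And>b. b < rk F (Suc i) \<Longrightarrow> const_term (y b) = v b" and "c < rk F i"
  shows "tensor_diff F i v c = const_term (diff_map F i y c)"
  using assms by (simp add: tensor_diff_def const_term_diff_map)

context free_resolution
begin

text \<open>A homogeneous entry with nonzero constant term has degree 0; hence the tensored
  differential preserves degrees.\<close>

lemma shift_eq_of_const_term:
  assumes "c < rk F i" and "b < rk F (Suc i)" and "const_term (differential F i c b) \<noteq> 0"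
  shows "shift F (Suc i) b = shift F i c"
  using const_term_homogeneous[OF homogeneous_differential[OF assms(1,2)] assms(3)] by simp

lemma tensor_diff_in_tensor_piece:
  assumes "v \<in> tensor_piece F (Suc i) j"
  shows "tensor_diff F i v \<in> tensor_piece F i j"
  unfolding tensor_piece_def
proof safe
  fix c assume nz: "tensor_diff F i v c \<noteq> 0"
  then show c: "c < rk F i" by (simp add: tensor_diff_def split: if_splits)
  with nz obtain b where b: "b < rk F (Suc i)" "const_term (differential F i c b) * v b \<noteq> 0"
    by (auto simp: tensor_diff_def elim: sum.not_neutral_contains_not_neutral)
  then show "shift F i c = j"
    using assms shift_eq_of_const_term[OF c b(1)] by (auto simp: tensor_piece_def)
qed

lemma tensor_diff_tensor_diff: "tensor_diff F i (tensor_diff F (Suc i) v) = (\<lambda>_. 0)"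
proof
  fix c
  show "tensor_diff F i (tensor_diff F (Suc i) v) c = 0"
  proof (cases "c < rk F i")
    case True
    then have "tensor_diff F i (tensor_diff F (Suc i) v) c =
        const_term (diff_map F i (diff_map F (Suc i) (\<lambda>b. single 0 (v b))) c)"
      by (intro tensor_diff_eq) (simp_all add: tensor_diff_eq[symmetric, of _ _ _ v])
    with True show ?thesis by (simp add: diff_map_diff_map const_term_def)
  qed (simp add: tensor_diff_def)
qed

lemma tor_boundaries_subset: "tor_boundaries F i j \<subseteq> tor_cycles F i j"
  by (auto simp: tor_boundaries_def tor_cycles_def tensor_diff_in_tensor_piece tensor_diff_tensor_diff)

lemma subspace_tor_boundaries: "fun_space.subspace (tor_boundaries F i j)"
proof (rule fun_space.subspaceI)
  have "tensor_diff F i (\<lambda>_. 0) = (\<lambda>_. 0)" by (auto simp: tensor_diff_def)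
  then show "0 \<in> tor_boundaries F i j"
    unfolding tor_boundaries_def by (intro image_eqI[of _ _ "\<lambda>_. 0"]) (auto simp: tensor_piece_def)
next
  fix v w assume "v \<in> tor_boundaries F i j" "w \<in> tor_boundaries F i j"
  then obtain v' w' where v': "v = tensor_diff F i v'" "v' \<in> tensor_piece F (Suc i) j"
    and w': "w = tensor_diff F i w'" "w' \<in> tensor_piece F (Suc i) j"
    by (auto simp: tor_boundaries_def)
  have "v + w = tensor_diff F i (\<lambda>b. v' b + w' b)"
    by (auto simp: v' w' tensor_diff_def distrib_left sum.distrib fun_eq_iff)
  moreover have "(\<lambda>b. v' b + w' b) \<in> tensor_piece F (Suc i) j"
    using v'(2) w'(2) by (auto simp: tensor_piece_def) (metis add_0)+
  ultimately show "v + w \<in> tor_boundaries F i j" by (auto simp: tor_boundaries_def)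
next
  fix c v assume "v \<in> tor_boundaries F i j"
  then obtain v' where v': "v = tensor_diff F i v'" "v' \<in> tensor_piece F (Suc i) j"
    by (auto simp: tor_boundaries_def)
  have "(\<lambda>b. c * v b) = tensor_diff F i (\<lambda>b. c * v' b)"
    by (auto simp: v' tensor_diff_def sum_distrib_left mult.left_commute fun_eq_iff)
  moreover have "(\<lambda>b. c * v' b) \<in> tensor_piece F (Suc i) j"
    using v'(2) by (auto simp: tensor_piece_def)
  ultimately show "(\<lambda>b. c * v b) \<in> tor_boundaries F i j" by (auto simp: tor_boundaries_def)
qed

lemma tor_cycles_subset_span:
  "tor_cycles F i j \<subseteq> fun_space.span ((\<lambda>a b. if b = a then 1 else 0) ` {..<rk F i})"
proof
  let ?e = "\<lambda>a b :: nat. if b = a then 1 else 0 :: 'k"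
  fix v assume "v \<in> tor_cycles F i j"
  then have "v b \<noteq> 0 \<Longrightarrow> b < rk F i" for b
    by (auto simp: tor_cycles_def tensor_piece_def)
  then have "(\<Sum>a<rk F i. v a * ?e a b) = v b" for b
    by (cases "b < rk F i") (auto simp: if_distrib[of "(*) _"] cong: if_cong)
  then have "v = (\<Sum>a<rk F i. (\<lambda>b. v a * ?e a b))"
    by (simp add: fun_eq_iff sum_apply)
  also have "\<dots> \<in> fun_space.span (?e ` {..<rk F i})"
    by (intro fun_space.span_sum fun_space.span_scale fun_space.span_base) simp
  finally show "v \<in> fun_space.span (?e ` {..<rk F i})" .
qed

lemma tor_dim_neq_0_iff: "tor_dim F i j \<noteq> 0 \<longleftrightarrow> (\<exists>v\<in>tor_cycles F i j. v \<notin> tor_boundaries F i j)"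
  unfolding tor_dim_def
  by (rule kdim_diff_neq_0_iff[OF tor_boundaries_subset subspace_tor_boundaries _ tor_cycles_subset_span]) simp

lemma socle_class_UNIV_iff:
  "socle_class UNIV D y \<longleftrightarrow> hom_vec F (CARD('n)) (D + int CARD('n)) y \<and>
     cycle_mod UNIV (CARD('n)) y \<and> \<not> bdry_mod UNIV (CARD('n)) y"
  by (auto simp: socle_class_def bdry_mod_def diff_map_def indet_mult_in_var_ideal intro!: exI[of _ "\<lambda>_. 0"])

lemma tor_class_imp_socle_class:
  assumes v: "v \<in> tor_cycles F i j" "v \<notin> tor_boundaries F i j"
  defines "y \<equiv> \<lambda>b. single 0 (v b)"
  shows "hom_vec F i j y" and "cycle_mod UNIV i y" and "\<not> bdry_mod UNIV i y"
proof -
  have piece: "v b \<noteq> 0 \<Longrightarrow> b < rk F i \<and> shift F i b = j" for b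
    using v(1) by (auto simp: tor_cycles_def tensor_piece_def)
  have y: "const_term (y b) = v b" for b by (simp add: y_def)
  show "hom_vec F i j y"
    using piece by (auto simp: hom_vec_def homogeneous_def y_def split: if_splits)
  show "cycle_mod UNIV i y"
    using v(1)
    by (auto simp: cycle_mod_def tor_cycles_def var_ideal_UNIV
        simp flip: const_term_def tensor_diff_eq[of _ _ y v] simp: y)
  show "\<not> bdry_mod UNIV i y"
  proof
    assume "bdry_mod UNIV i y"
    then obtain w where "\<forall>b<rk F i. const_term (y b - diff_map F i w b) = 0"
      by (auto simp: bdry_mod_def var_ideal_UNIV simp flip: const_term_def)
    then have w: "b < rk F i \<Longrightarrow> v b = const_term (diff_map F i w b)" for b
      by (simp add: const_term_diff y)
    \<comment> \<open>\<open>w\<close> need not be homogeneous. Constant terms at basis elements of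
      degree other than \<open>j\<close> are dropped; by \<open>shift_eq_of_const_term\<close> they
      do not affect coordinates of degree \<open>j\<close>.\<close>
    define u where "u b = (if b < rk F (Suc i) \<and> shift F (Suc i) b = j then const_term (w b) else 0)" for b
    have "tensor_diff F i u c = v c" for c
    proof (cases "c < rk F i \<and> shift F i c = j")
      case True
      then have "tensor_diff F i u c = const_term (diff_map F i w c)"
        unfolding tensor_diff_def const_term_diff_map
        using shift_eq_of_const_term[of c i] by (auto simp: u_def intro!: sum.cong) metis
      with True w show ?thesis by simp
    next
      case False
      have "u \<in> tensor_piece F (Suc i) j" by (simp add: tensor_piece_def u_def)
      from tensor_diff_in_tensor_piece[OF this] False have "tensor_diff F i u c = 0"
        unfolding tensor_piece_def by blast
      moreover have "v c = 0" using False piece by blast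
      ultimately show ?thesis by simp
    qed
    moreover have "u \<in> tensor_piece F (Suc i) j" by (simp add: tensor_piece_def u_def)
    ultimately show False
      using v(2) by (auto simp: tor_boundaries_def image_iff fun_eq_iff)
  qed
qed

lemma socle_class_imp_tor_class:
  assumes "hom_vec F i j y" and "cycle_mod UNIV i y" and "\<not> bdry_mod UNIV i y"
  defines "v \<equiv> \<lambda>b. if b < rk F i then const_term (y b) else 0"
  shows "v \<in> tor_cycles F i j" and "v \<notin> tor_boundaries F i j"
proof -
  have "shift F i b = j" if "b < rk F i" "const_term (y b) \<noteq> 0" for b
    using const_term_homogeneous[OF _ that(2), of "j - shift F i b"] assms(1) that(1)
    by (simp add: hom_vec_def)
  then have "v \<in> tensor_piece F i j"
    by (auto simp: tensor_piece_def v_def)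
  moreover have "tensor_diff F i' v = (\<lambda>_. 0)" if i: "i = Suc i'" for i'
  proof
    fix c
    show "tensor_diff F i' v c = 0"
    proof (cases "c < rk F i'")
      case True
      then have "tensor_diff F i' v c = const_term (diff_map F i' y c)"
        by (intro tensor_diff_eq) (simp_all add: v_def i)
      with True assms(2) show ?thesis
        by (simp add: cycle_mod_def i var_ideal_UNIV const_term_def)
    qed (simp add: tensor_diff_def)
  qed
  ultimately show "v \<in> tor_cycles F i j" by (simp add: tor_cycles_def)
  show "v \<notin> tor_boundaries F i j"
  proof
    assume "v \<in> tor_boundaries F i j"
    then obtain u where u: "v = tensor_diff F i u" by (auto simp: tor_boundaries_def)
    have "y b - diff_map F i (\<lambda>b. single 0 (u b)) b \<in> var_ideal UNIV" if b: "b < rk F i" for b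
    proof -
      have "const_term (y b) = tensor_diff F i u b"
        using b by (simp flip: u add: v_def)
      also have "\<dots> = const_term (diff_map F i (\<lambda>b. single 0 (u b)) b)"
        using b by (intro tensor_diff_eq) simp_all
      finally show ?thesis
        by (simp add: var_ideal_UNIV const_term_diff flip: const_term_def)
    qed
    with assms(3) show False by (auto simp: bdry_mod_def)
  qed
qed

theorem tor_dim_CARD_neq_0_iff:
  "tor_dim F (CARD('n)) j \<noteq> 0 \<longleftrightarrow>
    (\<exists>u. homogeneous (j - int CARD('n)) u \<and> u \<notin> J \<and> (\<forall>l. indet l * u \<in> J))"
proof -
  have "tor_dim F (CARD('n)) j \<noteq> 0 \<longleftrightarrow>
      (\<exists>y. hom_vec F (CARD('n)) j y \<and> cycle_mod UNIV (CARD('n)) y \<and> \<not> bdry_mod UNIV (CARD('n)) y)"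
    unfolding tor_dim_neq_0_iff
    by (meson tor_class_imp_socle_class socle_class_imp_tor_class)
  also have "\<dots> \<longleftrightarrow> (\<exists>y. socle_class UNIV (j - int CARD('n)) y)"
    by (simp add: socle_class_UNIV_iff)
  finally show ?thesis by (simp only: ex_socle_class)
qed

end

section \<open>Dickson's lemma\<close>

text \<open>A monotone subsequence exists; if it decreases, it is constant once it attains its
  minimum.\<close>

lemma nat_seq_incseq_subseq:
  fixes t :: "nat \<Rightarrow> nat"
  shows "\<exists>g. strict_mono g \<and> incseq (t \<circ> g)"
proof -
  obtain g where g: "strict_mono g" "monoseq (\<lambda>n. t (g n))"
    using seq_monosub[of t] by blast
  show ?thesis
  proof (cases "incseq (\<lambda>n. t (g n))")
    case True
    with g(1) show ?thesis by (auto simp: comp_def)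
  next
    case False
    with g(2) have dec: "decseq (\<lambda>n. t (g n))" by (simp add: monoseq_iff)
    obtain N where "\<And>k. t (g N) \<le> t (g k)"
      using ex_has_least_nat[of "\<lambda>_. True" 0 "\<lambda>n. t (g n)"] by blast
    moreover have "t (g (N + k)) \<le> t (g N)" for k
      using dec by (simp add: decseq_def)
    ultimately have "t (g (N + k)) = t (g N)" for k
      using order.antisym by blast
    then have "incseq (t \<circ> (\<lambda>k. g (N + k)))" by (simp add: incseq_def)
    moreover have "strict_mono (\<lambda>k. g (N + k))"
      using g(1) by (simp add: strict_mono_def)
    ultimately show ?thesis by blast
  qed
qed

lemma exponent_seq_mono_subseq:
  fixes s :: "nat \<Rightarrow> 'n \<Rightarrow>\<^sub>0 nat"
  assumes "finite A"
  shows "\<exists>f. strict_mono f \<and> (\<forall>i\<in>A. incseq (\<lambda>k. lookup (s (f k)) i))"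
  using assms
proof (induction A)
  case empty
  show ?case by (intro exI[of _ id]) (simp add: strict_mono_def)
next
  case (insert i A)
  then obtain f where f: "strict_mono f" "\<forall>i\<in>A. incseq (\<lambda>k. lookup (s (f k)) i)" by blast
  obtain g where g: "strict_mono g" "incseq ((\<lambda>k. lookup (s (f k)) i) \<circ> g)"
    using nat_seq_incseq_subseq by blast
  have "incseq (\<lambda>k. lookup (s ((f \<circ> g) k)) i')" if "i' \<in> A" for i'
    using f(2) that strict_mono_mono[OF g(1)] by (simp add: incseq_def mono_def)
  then have "\<forall>i'\<in>insert i A. incseq (\<lambda>k. lookup (s ((f \<circ> g) k)) i')"
    using g(2) by (simp add: comp_def)
  with strict_mono_o[OF f(1) g(1)] show ?case by blast
qed

text \<open>Otherwise one could keep picking elements of \<open>L\<close> that no earlier pick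
  divides, but some subsequence of the picks increases in all coordinates.\<close>

lemma dickson:
  fixes L :: "('n::finite \<Rightarrow>\<^sub>0 nat) set"
  shows "\<exists>L0\<subseteq>L. finite L0 \<and> (\<forall>m\<in>L. \<exists>a\<in>L0. \<forall>i. lookup a i \<le> lookup m i)"
proof (rule ccontr)
  define le where "le a m \<longleftrightarrow> (\<forall>i. lookup a i \<le> lookup m i)" for a m :: "'n \<Rightarrow>\<^sub>0 nat"
  assume "\<not> ?thesis"
  then have "\<exists>m. m \<in> L \<and> (\<forall>a\<in>A. \<not> le a m)" if "A \<subseteq> L" "finite A" for A
    unfolding le_def[symmetric] using that by blast
  then obtain pick where pick: "\<And>A. A \<subseteq> L \<Longrightarrow> finite A \<Longrightarrow> pick A \<in> L \<and> (\<forall>a\<in>A. \<not> le a (pick A))"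
    by metis
  define C where "C = rec_nat {} (\<lambda>_ A. insert (pick A) A)"
  have C_0: "C 0 = {}" and C_Suc: "C (Suc n) = insert (pick (C n)) (C n)" for n
    by (simp_all add: C_def)
  have C: "C n \<subseteq> L \<and> finite (C n)" for n
    by (induction n) (simp_all add: C_0 C_Suc pick)
  have pick_in: "pick (C m) \<in> C n" if "m < n" for m n
    using that by (induction n) (auto simp: C_Suc less_Suc_eq)
  obtain f where f: "strict_mono f" "\<And>i. incseq (\<lambda>k. lookup (pick (C (f k))) i)"
    using exponent_seq_mono_subseq[of UNIV "\<lambda>n. pick (C n)"] by auto
  have "f 0 < f 1" using f(1) by (simp add: strict_mono_def)
  with pick[of "C (f 1)"] C pick_in have "\<not> le (pick (C (f 0))) (pick (C (f 1)))"
    by blast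
  moreover have "le (pick (C (f 0))) (pick (C (f 1)))"
    using f(2) by (simp add: incseq_def le_def)
  ultimately show False by blast
qed

section \<open>Hilbert's basis theorem for graded submodules of free modules\<close>

text \<open>Comparing the values of \<open>\<phi>\<close> is a monomial order. Sending the variables to distinct primes
  makes it total and well-founded without an order on the variables.\<close>

lemma ex_monomial_weight:
  obtains \<phi> :: "('n::finite \<Rightarrow>\<^sub>0 nat) \<Rightarrow> nat"
  where "inj \<phi>" and "\<And>a b. \<phi> (a + b) = \<phi> a * \<phi> b" and "\<And>a. \<phi> a > 0"
proof -
  obtain e :: "'n \<Rightarrow> nat" where e: "inj e"
    using finite_imp_inj_to_nat_seg[of "UNIV :: 'n set"] by auto
  obtain q :: "nat \<Rightarrow> nat" where q: "inj q" "range q \<subseteq> {p. Factorial_Ring.prime p}"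
    using infinite_countable_subset[OF primes_infinite] by blast
  define p where "p i = q (e i)" for i
  have prime: "Factorial_Ring.prime (p i)" for i using q(2) by (auto simp: p_def)
  have nonzero: "p i \<noteq> 0" for i
    using prime_gt_0_nat[OF prime[of i]] by simp
  have p_eq: "p i = p j \<longleftrightarrow> i = j" for i j
    using e q(1) by (auto simp: p_def inj_def)
  define \<phi> where "\<phi> m = (\<Prod>i\<in>UNIV. p i ^ lookup m i)" for m
  \<comment> \<open>Unique factorisation recovers each exponent from the weight, which gives
    injectivity.\<close>
  have "multiplicity (p j) (\<phi> m) = lookup m j" for j m
  proof -
    have "0 \<notin> (\<lambda>i. p i ^ lookup m i) ` UNIV"
    proof
      assume "0 \<in> (\<lambda>i. p i ^ lookup m i) ` UNIV"
      then obtain i where "0 = p i ^ lookup m i" by blast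
      with power_not_zero[OF nonzero[of i], of "lookup m i"] show False by metis
    qed
    then have "multiplicity (p j) (\<phi> m) = (\<Sum>i\<in>UNIV. multiplicity (p j) (p i ^ lookup m i))"
      unfolding \<phi>_def using prime by (intro prime_elem_multiplicity_prod_distrib) auto
    also have "\<dots> = (\<Sum>i\<in>UNIV. if i = j then lookup m i else 0)"
      using prime by (intro sum.cong)
        (auto simp: multiplicity_distinct_prime_power p_eq)
    finally show ?thesis by simp
  qed
  then have "inj \<phi>"
    by (metis injI poly_mapping_eqI)
  moreover have "\<phi> (a + b) = \<phi> a * \<phi> b" for a b
    by (simp add: \<phi>_def lookup_add power_add prod.distrib)
  moreover have "\<phi> a > 0" for a
    using prime by (simp add: \<phi>_def prime_gt_0_nat prod_pos)
  ultimately show thesis using that by blast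
qed


lemma less_lex_mult_add:
  fixes r :: nat
  assumes "b < r" "b' < r"
  shows "p * r + b < p' * r + b' \<longleftrightarrow> p < p' \<or> p = p' \<and> b < b'"
proof -
  have *: "p * r + b < p' * r + b'" if "p < p'" "b < r" for p p' b b'
  proof -
    have "p * r + b < Suc p * r" using that(2) by simp
    also have "\<dots> \<le> p' * r" using that(1) by (intro mult_right_mono) auto
    finally show ?thesis by simp
  qed
  show ?thesis
    using *[of p p' b b'] *[of p' p b' b] assms by (cases p p' rule: linorder_cases) auto
qed

text \<open>\<open>M\<close> is a graded submodule of a free module whose \<open>b\<close>-th basis
  element has degree \<open>s b\<close>. Dickson's lemma leaves finitely many leading terms at each
  position, and homogeneous elements realising them generate \<open>M\<close>. Coordinates from
  \<open>r\<close> on are junk, hence the closure condition \<open>cong\<close>.\<close>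

lemma graded_submodule_generators:
  fixes M :: "(nat \<Rightarrow> ('n::finite, 'k::field) mpoly) set" and r :: nat and s :: "nat \<Rightarrow> int"
  assumes zero: "(\<lambda>_. 0) \<in> M"
    and add: "\<And>v w. v \<in> M \<Longrightarrow> w \<in> M \<Longrightarrow> (\<lambda>b. v b + w b) \<in> M"
    and mult: "\<And>p v. v \<in> M \<Longrightarrow> (\<lambda>b. p * v b) \<in> M"
    and hpart: "\<And>D v. v \<in> M \<Longrightarrow> (\<lambda>b. hpart (D - s b) (v b)) \<in> M"
    and cong: "\<And>v w. v \<in> M \<Longrightarrow> (\<And>b. b < r \<Longrightarrow> v b = w b) \<Longrightarrow> w \<in> M"
  shows "\<exists>N t g. (\<forall>b<r. \<forall>a<N. homogeneous (t a - s b) (g b a)) \<and>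
    (\<forall>v. v \<in> M \<longleftrightarrow> (\<exists>w. \<forall>b<r. v b = (\<Sum>a<(N::nat). g b a * w a)))"
proof -
  obtain \<phi> :: "('n \<Rightarrow>\<^sub>0 nat) \<Rightarrow> nat"
    where \<phi>: "inj \<phi>" "\<And>a b. \<phi> (a + b) = \<phi> a * \<phi> b" "\<And>a. \<phi> a > 0"
    using ex_monomial_weight by blast
  \<comment> \<open>Term-over-position order as one natural number: \<open>b < r\<close> is the last
    digit in base \<open>r\<close>, so induction on numbers replaces well-foundedness.\<close>
  define key where "key m b = \<phi> m * r + b" for m b
  have key_inj: "m = m' \<and> b = b'" if "key m b = key m' b'" "b < r" "b' < r" for m m' b b'
    using that less_lex_mult_add[of b r b' "\<phi> m" "\<phi> m'"] less_lex_mult_add[of b' r b "\<phi> m'" "\<phi> m"] \<phi>(1)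
    by (auto simp: key_def inj_def)
  have key_add: "key (a + m) b < key (a + m') b'" if "key m b < key m' b'" "b < r" "b' < r" for a m m' b b'
    using that \<phi>(3)[of a] unfolding key_def less_lex_mult_add[OF that(2,3)] by (auto simp: \<phi>(2))
  define below where "below n v \<longleftrightarrow> (\<forall>b<r. \<forall>m\<in>keys (v b). key m b < n)"
    for n and v :: "nat \<Rightarrow> ('n, 'k) mpoly"
  define lead where "lead v m b \<longleftrightarrow> b < r \<and> lookup (v b) m \<noteq> 0 \<and> below (Suc (key m b)) v" for v m b
  define le where "le a m \<longleftrightarrow> (\<forall>i. lookup a i \<le> lookup m i)" for a m :: "'n \<Rightarrow>\<^sub>0 nat"
  define leads where "leads b = {m. \<exists>v\<in>M. lead v m b}" for b
  have "\<forall>b. \<exists>L. L \<subseteq> leads b \<and> finite L \<and> (\<forall>m\<in>leads b. \<exists>a\<in>L. le a m)"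
    unfolding le_def by (intro allI dickson)
  from choice[OF this] obtain L where
    L: "\<And>b. L b \<subseteq> leads b" "\<And>b. finite (L b)" "\<And>b m. m \<in> leads b \<Longrightarrow> \<exists>a\<in>L b. le a m"
    by blast
  define T where "T = Sigma {..<r} L"
  have "finite T" using L(2) by (auto simp: T_def)
  define deg where "deg \<tau> = int (mdeg (snd \<tau>)) + s (fst \<tau>)" for \<tau> :: "nat \<times> ('n \<Rightarrow>\<^sub>0 nat)"
  have "\<exists>v\<in>M. lead v (snd \<tau>) (fst \<tau>) \<and> (\<forall>b. homogeneous (deg \<tau> - s b) (v b))" if "\<tau> \<in> T" for \<tau>
  proof -
    from that have "snd \<tau> \<in> leads (fst \<tau>)"
      using subsetD[OF L(1)] by (auto simp: T_def)
    then obtain v where v: "v \<in> M" "lead v (snd \<tau>) (fst \<tau>)"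
      by (auto simp: leads_def)
    \<comment> \<open>The homogeneous component in the degree of the leading term keeps that term
      and can only lose others.\<close>
    let ?v = "\<lambda>b. hpart (deg \<tau> - s b) (v b)"
    have "lead ?v (snd \<tau>) (fst \<tau>)"
      using v(2) by (auto simp: lead_def below_def keys_hpart lookup_hpart deg_def)
    with hpart[OF v(1)] show ?thesis
      using homogeneous_hpart by (intro bexI[of _ ?v]) auto
  qed
  then obtain G where G: "\<And>\<tau>. \<tau> \<in> T \<Longrightarrow> G \<tau> \<in> M" "\<And>\<tau>. \<tau> \<in> T \<Longrightarrow> lead (G \<tau>) (snd \<tau>) (fst \<tau>)"
    "\<And>\<tau> b. \<tau> \<in> T \<Longrightarrow> homogeneous (deg \<tau> - s b) (G \<tau> b)"
    by metis

  \<comment> \<open>division with remainder by the Groebner basis \<open>G\<close>\<close>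
  have reduce: "\<exists>w. \<forall>b<r. v b = (\<Sum>\<tau>\<in>T. G \<tau> b * w \<tau>)" if "below n v" "v \<in> M" for n v
    using that
  proof (induction n arbitrary: v)
    case 0
    then have "\<forall>b<r. keys (v b) = {}" by (auto simp: below_def)
    then have "\<forall>b<r. v b = 0" by (metis empty_iff in_keys_iff lookup_zero poly_mapping_eqI)
    then show ?case by (intro exI[of _ "\<lambda>_. 0"]) simp
  next
    case (Suc n)
    show ?case
    proof (cases "\<exists>b<r. \<exists>m\<in>keys (v b). key m b = n")
      case False
      then have "below n v"
        using Suc.prems(1) by (auto simp: below_def less_Suc_eq)
      with Suc show ?thesis by blast
    next
      case True
      then obtain b m where b: "b < r" and m: "m \<in> keys (v b)" and n: "key m b = n" by blast
      then have "m \<in> leads b"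
        using Suc.prems by (auto simp: leads_def lead_def in_keys_iff)
      then obtain a where a: "a \<in> L b" and le: "\<And>i. lookup a i \<le> lookup m i"
        using L(3) unfolding le_def by blast
      let ?g = "G (b, a)"
      have T: "(b, a) \<in> T" using a b by (simp add: T_def)
      have g: "lookup (?g b) a \<noteq> 0" "below (Suc (key a b)) ?g"
        using G(2)[OF T] by (simp_all add: lead_def)
      have m_eq: "m - a + a = m"
        using exponent_decomp[of a m] le by (simp add: add.commute)
      \<comment> \<open>Chosen so that \<open>q * ?g\<close> cancels the term of \<open>v\<close> at
        \<open>m\<close> in position \<open>b\<close>, while by \<open>key_add\<close> its other
        terms stay below.\<close>
      define q :: "('n, 'k) mpoly" where "q = single (m - a) (- lookup (v b) m / lookup (?g b) a)"
      let ?v = "\<lambda>b'. v b' + q * ?g b'"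
      have "key m' b' < n" if b': "b' < r" and m': "m' \<in> keys (?v b')" for b' m'
      proof -
        have "m' \<in> keys (v b') \<or> m' \<in> keys (q * ?g b')"
          using m' keys_add[of "v b'" "q * ?g b'"] by blast
        then have "key m' b' \<le> n"
        proof
          assume "m' \<in> keys (v b')"
          with Suc.prems(1) b' show ?thesis unfolding below_def less_Suc_eq_le by blast
        next
          assume "m' \<in> keys (q * ?g b')"
          then obtain c where c: "c \<in> keys (?g b')" "m' = m - a + c"
            by (auto simp: q_def dest!: keys_multD split: if_splits)
          with g(2) b' have "key c b' \<le> key a b"
            unfolding below_def less_Suc_eq_le by blast
          then consider "key c b' < key a b" | "key c b' = key a b"
            by linarith
          then show ?thesis
          proof cases
            case 1
            from key_add[OF this b' b, of "m - a"] show ?thesis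
              by (simp add: c(2) m_eq n)
          next
            case 2
            from key_inj[OF this b' b] show ?thesis
              by (simp add: c(2) m_eq n)
          qed
        qed
        moreover have "key m' b' \<noteq> n"
        proof
          assume "key m' b' = n"
          then have "m' = m \<and> b' = b" using key_inj[OF _ b' b, of m' m] n by simp
          moreover have "lookup (q * ?g b) m = - lookup (v b) m"
            using lookup_single_times_add[of "m - a" _ "?g b" a] g(1) by (simp add: q_def m_eq)
          ultimately have "lookup (?v b') m' = 0" by (simp add: lookup_add)
          with m' show False by (simp add: in_keys_iff)
        qed
        ultimately show ?thesis by simp
      qed
      then have "below n ?v" unfolding below_def by blast
      moreover have "?v \<in> M" by (rule add[OF Suc.prems(2) mult[OF G(1)[OF T]]])
      ultimately obtain w where w: "\<And>b'. b' < r \<Longrightarrow> ?v b' = (\<Sum>\<tau>\<in>T. G \<tau> b' * w \<tau>)"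
        using Suc.IH by blast
      have "v b' = (\<Sum>\<tau>\<in>T. G \<tau> b' * (w \<tau> - (if \<tau> = (b, a) then q else 0)))" if b': "b' < r" for b'
      proof -
        have "(\<Sum>\<tau>\<in>T. G \<tau> b' * (if \<tau> = (b, a) then q else 0)) = q * ?g b'"
          using \<open>finite T\<close> T by (simp add: if_distrib[of "\<lambda>x. _ * x"] mult.commute cong: if_cong)
        with w[OF b'] show ?thesis
          by (simp only: right_diff_distrib sum_subtractf eq_diff_eq)
      qed
      then show ?thesis
        by (intro exI[of _ "\<lambda>\<tau>. w \<tau> - (if \<tau> = (b, a) then q else 0)"]) simp
    qed
  qed
  have "\<exists>n. below n v" for v
  proof -
    have "finite ((\<lambda>(b, m). key m b) ` Sigma {..<r} (\<lambda>b. keys (v b)))" by simp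
    then obtain n where "\<forall>k\<in>(\<lambda>(b, m). key m b) ` Sigma {..<r} (\<lambda>b. keys (v b)). k < n"
      unfolding finite_nat_set_iff_bounded by blast
    then have "\<forall>(b, m)\<in>Sigma {..<r} (\<lambda>b. keys (v b)). key m b < n"
      by (simp add: case_prod_beta)
    then have "below n v" by (simp add: below_def)
    then show ?thesis by blast
  qed
  with reduce have generated: "\<exists>w. \<forall>b<r. v b = (\<Sum>\<tau>\<in>T. G \<tau> b * w \<tau>)" if "v \<in> M" for v
    using that by blast
  have combination: "(\<lambda>b. \<Sum>\<tau>\<in>T'. G \<tau> b * w \<tau>) \<in> M" if "T' \<subseteq> T" for T' w
  proof -
    have "finite T'" using that \<open>finite T\<close> by (rule finite_subset)
    then show ?thesis using that
    proof (induction T')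
      case (insert \<tau> T')
      then have "(\<lambda>b. w \<tau> * G \<tau> b + (\<Sum>\<tau>\<in>T'. G \<tau> b * w \<tau>)) \<in> M"
        by (intro add mult G(1)) auto
      with insert show ?case by (simp add: mult.commute)
    qed (simp add: zero)
  qed
  obtain h where h: "bij_betw h {..<card T} T"
    using ex_bij_betw_nat_finite[OF \<open>finite T\<close>] by (auto simp: atLeast0LessThan)
  have reindex: "(\<Sum>a<card T. G (h a) b * w (h a)) = (\<Sum>\<tau>\<in>T. G \<tau> b * w \<tau>)" for b w
    using sum.reindex_bij_betw[OF h, of "\<lambda>\<tau>. G \<tau> b * w \<tau>"] .
  have inv: "the_inv_into {..<card T} h (h a) = a" if "a < card T" for a
    using h that by (auto simp: bij_betw_def intro: the_inv_into_f_f)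
  have "homogeneous (deg (h a) - s b) (G (h a) b)" if "a < card T" for a b
    using G(3) bij_betwE[OF h] that by blast
  moreover have "v \<in> M \<longleftrightarrow> (\<exists>w. \<forall>b<r. v b = (\<Sum>a<card T. G (h a) b * w a))" for v
  proof
    assume "v \<in> M"
    then obtain w where "\<forall>b<r. v b = (\<Sum>\<tau>\<in>T. G \<tau> b * w \<tau>)"
      using generated by blast
    then show "\<exists>w. \<forall>b<r. v b = (\<Sum>a<card T. G (h a) b * w a)"
      by (intro exI[of _ "\<lambda>a. w (h a)"]) (simp only: reindex simp_thms)
  next
    assume "\<exists>w. \<forall>b<r. v b = (\<Sum>a<card T. G (h a) b * w a)"
    then obtain w where w: "\<And>b. b < r \<Longrightarrow> v b = (\<Sum>a<card T. G (h a) b * w a)" by blast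
    have "(\<Sum>\<tau>\<in>T. G \<tau> b * w (the_inv_into {..<card T} h \<tau>)) = v b" if "b < r" for b
      unfolding reindex[symmetric] w[OF that] by (intro sum.cong) (simp_all add: inv)
    then show "v \<in> M"
      by (intro cong[OF combination[OF subset_refl]])
  qed
  ultimately show ?thesis
    by (intro exI[of _ "card T"] exI[of _ "\<lambda>a. deg (h a)"] exI[of _ "\<lambda>b a. G (h a) b"]) simp
qed

section \<open>Existence of graded free resolutions\<close>

text \<open>The analogue of \<open>diff_map_hpart_vec\<close> for a bare matrix, usable while the
  resolution is still being built.\<close>

lemma matrix_hpart:
  fixes A :: "nat \<Rightarrow> nat \<Rightarrow> ('n::finite, 'k::field) mpoly"
  assumes "\<And>b. b < r \<Longrightarrow> homogeneous (s b - e) (A c b)"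
  shows "(\<Sum>b<r. A c b * hpart (D - s b) (v b)) = hpart (D - e) (\<Sum>b<r. A c b * v b)"
  unfolding hpart_sum
proof (rule sum.cong)
  fix b assume "b \<in> {..<r}"
  with hpart_mult[OF assms, of b "D - e" "D - s b"]
  show "A c b * hpart (D - s b) (v b) = hpart (D - e) (A c b * v b)" by simp
qed simp

lemma graded_kernel_generators:
  fixes A :: "nat \<Rightarrow> nat \<Rightarrow> ('n::finite, 'k::field) mpoly"
  assumes "\<And>c b. c < r0 \<Longrightarrow> b < r1 \<Longrightarrow> homogeneous (s1 b - s0 c) (A c b)"
  shows "\<exists>N t g. (\<forall>b<r1. \<forall>a<N. homogeneous (t a - s1 b) (g b a)) \<and>
    (\<forall>v. (\<forall>c<r0. (\<Sum>b<r1. A c b * v b) = 0) \<longleftrightarrow> (\<exists>w. \<forall>b<r1. v b = (\<Sum>a<(N::nat). g b a * w a)))"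
proof -
  let ?M = "{v. \<forall>c<r0. (\<Sum>b<r1. A c b * v b) = 0}"
  have "(\<Sum>b<r1. A c b * hpart (D - s1 b) (v b)) = 0" if "c < r0" "(\<Sum>b<r1. A c b * v b) = 0" for c v D
    using matrix_hpart[of r1 s1 "s0 c" A c D v] assms that by (simp add: hpart_def)
  moreover have "(\<Sum>b<r1. A c b * (p * v b)) = p * (\<Sum>b<r1. A c b * v b)" for p v c
    by (simp add: sum_distrib_left mult.left_commute)
  ultimately have "\<exists>N t g. (\<forall>b<r1. \<forall>a<N. homogeneous (t a - s1 b) (g b a)) \<and>
    (\<forall>v. v \<in> ?M \<longleftrightarrow> (\<exists>w. \<forall>b<r1. v b = (\<Sum>a<(N::nat). g b a * w a)))"
    by (intro graded_submodule_generators) (auto simp: distrib_left sum.distrib)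
  then show ?thesis by simp
qed

text \<open>The ideal is treated as a submodule of the free module of rank 1 with shift 0.\<close>

lemma graded_ideal_generators:
  fixes J :: "('n::finite, 'k::field) mpoly set"
  assumes "graded_ideal J"
  shows "\<exists>N t g. (\<forall>a<N. homogeneous (t a) (g a)) \<and>
    (\<forall>p. p \<in> J \<longleftrightarrow> (\<exists>w. p = (\<Sum>a<(N::nat). g a * w a)))"
proof -
  note J = ideal_mpoly_ring[OF assms[unfolded graded_ideal_def, THEN conjunct1]]
  let ?M = "{v :: nat \<Rightarrow> ('n, 'k) mpoly. v 0 \<in> J}"
  have "\<exists>N t g. (\<forall>b<1. \<forall>a<N. homogeneous (t a - 0) (g b a)) \<and>
    (\<forall>v. v \<in> ?M \<longleftrightarrow> (\<exists>w. \<forall>b<1. v b = (\<Sum>a<(N::nat). g b a * w a)))"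
    using J(1-3) graded_ideal_hpart[OF assms]
    by (intro graded_submodule_generators) auto
  then obtain N t g where g: "\<forall>a<N. homogeneous (t a) (g (0::nat) a)"
    and J_eq: "\<forall>v :: nat \<Rightarrow> _. v 0 \<in> J \<longleftrightarrow> (\<exists>w. v 0 = (\<Sum>a<(N::nat). g 0 a * w a))"
    by auto
  have "p \<in> J \<longleftrightarrow> (\<exists>w. p = (\<Sum>a<N. g 0 a * w a))" for p
    using spec[OF J_eq, of "\<lambda>_. p"] .
  with g show ?thesis by blast
qed

theorem ex_graded_free_resolution:
  fixes J :: "('n::finite, 'k::field) mpoly set"
  assumes "graded_ideal J"
  shows "\<exists>F. graded_free_resolution J F"
proof -
  obtain N t g where g: "\<And>a. a < N \<Longrightarrow> homogeneous (t a) (g a)"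
    and J: "\<And>p. p \<in> J \<longleftrightarrow> (\<exists>w. p = (\<Sum>a<(N::nat). g a * w a))"
    using graded_ideal_generators[OF assms] by blast
  \<comment> \<open>A tuple is one map of the resolution: rank and shifts of target and source, then
    the matrix. \<open>next_map\<close> glues two maps along the common module and demands exactness
    there.\<close>
  define hom where "hom x \<longleftrightarrow> (case x of (r0, s0, r1, s1, A) \<Rightarrow>
      \<forall>c<r0. \<forall>b<r1. homogeneous (s1 b - s0 c) (A c b))"
    for x :: "nat \<times> (nat \<Rightarrow> int) \<times> nat \<times> (nat \<Rightarrow> int) \<times> (nat \<Rightarrow> nat \<Rightarrow> ('n, 'k) mpoly)"
  define next_map where "next_map x y \<longleftrightarrow> (case x of (r0, s0, r1, s1, A) \<Rightarrow> case y of (r1', s1', r2, s2, B) \<Rightarrow>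
      r1' = r1 \<and> s1' = s1 \<and>
      (\<forall>v. (\<forall>c<r0. (\<Sum>b<r1. A c b * v b) = 0) \<longleftrightarrow> (\<exists>w. \<forall>b<r1. v b = (\<Sum>a<r2. B b a * w a))))"
    for x y :: "nat \<times> (nat \<Rightarrow> int) \<times> nat \<times> (nat \<Rightarrow> int) \<times> (nat \<Rightarrow> nat \<Rightarrow> ('n, 'k) mpoly)"
  define start where "start = (1::nat, (\<lambda>_::nat. 0::int), N, t, (\<lambda>_::nat. g))"
  have "\<exists>y. hom y \<and> next_map x y" if "hom x" for x
  proof -
    obtain r0 s0 r1 s1 A where x: "x = (r0, s0, r1, s1, A)" by (cases x)
    with that have "\<And>c b. c < r0 \<Longrightarrow> b < r1 \<Longrightarrow> homogeneous (s1 b - s0 c) (A c b)"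
      by (simp add: hom_def)
    from graded_kernel_generators[of r0 r1 s1 s0 A, OF this] obtain r2 s2 B where
      "\<forall>b<r1. \<forall>a<r2. homogeneous (s2 a - s1 b) (B b a)"
      "\<forall>v. (\<forall>c<r0. (\<Sum>b<r1. A c b * v b) = 0) \<longleftrightarrow>
        (\<exists>w. \<forall>b<r1. v b = (\<Sum>a<(r2::nat). B b a * w a))"
      by blast
    then show ?thesis
      by (intro exI[of _ "(r1, s1, r2, s2, B)"]) (simp add: x hom_def next_map_def)
  qed
  \<comment> \<open>Dependent choice alone does not fix the initial element; the clause for
    \<open>n = 0\<close> forces it to be \<open>start\<close>, the row of generators of
    \<open>J\<close>.\<close>
  then have step: "\<exists>y. (hom y \<and> (Suc n = 0 \<longrightarrow> y = start)) \<and> next_map x y"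
    if "hom x \<and> (n = 0 \<longrightarrow> x = start)" for x n
    using that by simp
  have "hom start" using g by (simp add: hom_def start_def)
  then have "\<exists>x. hom x \<and> ((0::nat) = 0 \<longrightarrow> x = start)" by blast
  from dependent_nat_choice[of "\<lambda>n x. hom x \<and> (n = 0 \<longrightarrow> x = start)" "\<lambda>_. next_map", OF this step]
  obtain f where "\<forall>n. (hom (f n) \<and> (n = 0 \<longrightarrow> f n = start)) \<and> next_map (f n) (f (Suc n))"
    by blast
  then have f: "hom (f n)" "f 0 = start" "next_map (f n) (f (Suc n))" for n
    by simp_all
  define r where "r n = fst (f n)" for n
  define s where "s n = fst (snd (f n))" for n
  define A where "A n = snd (snd (snd (snd (f n))))" for n
  have f_eq: "f n = (r n, s n, r (Suc n), s (Suc n), A n)" for n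
    using f(3)[of n] by (auto simp: next_map_def r_def s_def A_def split: prod.splits)
  have hom: "homogeneous (s (Suc n) b - s n c) (A n c b)" if "c < r n" "b < r (Suc n)" for n c b
    using f(1)[of n] that by (simp add: f_eq hom_def)
  have exact: "(\<forall>c<r n. (\<Sum>b<r (Suc n). A n c b * v b) = 0) \<longleftrightarrow>
      (\<exists>w. \<forall>b<r (Suc n). v b = (\<Sum>a<r (Suc (Suc n)). A (Suc n) b a * w a))" for n v
    using f(3)[of n] by (simp add: f_eq next_map_def)
  have start: "r 0 = 1" "s 0 = (\<lambda>_. 0)" "r (Suc 0) = N" "A 0 = (\<lambda>_. g)"
    using f(2) f_eq[of 0] by (simp_all add: start_def)
  define F where "F = \<lparr>rk = r, shift = s, differential = A, augmentation = \<lambda>_. 1 :: ('n, 'k) mpoly\<rparr>"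
  have F [simp]: "rk F = r" "shift F = s" "differential F = A" "augmentation F = (\<lambda>_. 1)"
    by (simp_all add: F_def)
  have aug: "aug_map F v = v 0" for v
    by (simp add: aug_map_def start)
  have "graded_free_resolution J F"
    unfolding graded_free_resolution_def
  proof (intro conjI allI impI)
    show "homogeneous (shift F 0 b) (augmentation F b)" for b
      by (simp add: start homogeneous_def)
    show "\<exists>v. p - aug_map F v \<in> J" for p
      using ideal_mpoly_ring(1)[of J] assms
      by (intro exI[of _ "\<lambda>_. p"]) (simp add: aug graded_ideal_def)
    show "aug_map F v \<in> J \<longleftrightarrow> (\<exists>w. \<forall>c<rk F 0. v c = diff_map F 0 w c)" for v
      by (simp add: aug J diff_map_def start)
  qed (simp_all add: hom exact diff_map_def)
  then show ?thesis ..
qed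

section \<open>Monomial ideals\<close>

text \<open>The polynomials on the right form an ideal containing the monomials of \<open>I\<close>,
  which gives one inclusion; conversely each is a combination of its own monomials. In particular
  \<open>I\<close> and \<open>mono_ideal I\<close> have the same monomials.\<close>

lemma mem_mono_ideal_iff:
  fixes I :: "('n::finite, 'k::field) mpoly set"
  assumes "ideal I mpoly_ring"
  shows "p \<in> mono_ideal I \<longleftrightarrow> (\<forall>m\<in>keys p. single m 1 \<in> I)"
proof
  note I = ideal_mpoly_ring[OF assms]
  interpret R: cring "mpoly_ring :: ('n, 'k) mpoly ring" ..
  have carrier: "carrier (mpoly_ring :: ('n, 'k) mpoly ring) = UNIV"
    by (simp add: ring_of_type_algebra_def)
  let ?K = "{p. \<forall>m\<in>keys p. single m 1 \<in> I}"
  {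
    have "ideal ?K (mpoly_ring :: ('n, 'k) mpoly ring)"
    proof (rule idealI)
      show "ring (mpoly_ring :: ('n, 'k) mpoly ring)" ..
      have minus: "\<ominus>\<^bsub>mpoly_ring\<^esub> p = - p" for p :: "('n, 'k) mpoly"
        by (rule R.minus_equality) (simp_all add: ring_of_type_algebra_def)
      show "subgroup ?K (add_monoid (mpoly_ring :: ('n, 'k) mpoly ring))"
      proof
        fix p q :: "('n, 'k) mpoly" assume "p \<in> ?K" "q \<in> ?K"
        then show "p \<otimes>\<^bsub>add_monoid mpoly_ring\<^esub> q \<in> ?K"
          using keys_add[of p q] by (auto simp: ring_of_type_algebra_def)
      next
        fix p :: "('n, 'k) mpoly" assume "p \<in> ?K"
        then show "inv\<^bsub>add_monoid mpoly_ring\<^esub> p \<in> ?K"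
          unfolding a_inv_def[symmetric] minus by (auto simp: in_keys_iff)
      qed (simp_all add: ring_of_type_algebra_def)
      have "q * p \<in> ?K" if "p \<in> ?K" for p q :: "('n, 'k) mpoly"
      proof safe
        fix m assume "m \<in> keys (q * p)"
        then obtain a b where ab: "b \<in> keys p" "m = a + b"
          using keys_multD by blast
        then have "single a 1 * single b 1 \<in> I"
          using that by (intro I(3)) simp
        then show "single m 1 \<in> I" by (simp add: ab mult_single)
      qed
      then show "p \<in> ?K \<Longrightarrow> q \<otimes>\<^bsub>mpoly_ring\<^esub> p \<in> ?K" "p \<in> ?K \<Longrightarrow> p \<otimes>\<^bsub>mpoly_ring\<^esub> q \<in> ?K" for p q :: "('n, 'k) mpoly"
        by (simp_all add: ring_of_type_algebra_def mult.commute[of p q])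
    qed
    then have "mono_ideal I \<subseteq> ?K"
      unfolding mono_ideal_def by (rule R.genideal_minimal) (auto simp: monomials_def)
    then show "p \<in> mono_ideal I \<Longrightarrow> \<forall>m\<in>keys p. single m 1 \<in> I" by blast
  next
    assume p: "\<forall>m\<in>keys p. single m 1 \<in> I"
    have "ideal (mono_ideal I) (mpoly_ring :: ('n, 'k) mpoly ring)"
      unfolding mono_ideal_def by (rule R.genideal_ideal) (simp add: carrier)
    note K = ideal_mpoly_ring[OF this]
    have gen: "I \<inter> monomials \<subseteq> mono_ideal I"
      unfolding mono_ideal_def by (rule R.genideal_self) (simp add: carrier)
    have monomial: "single m (lookup p m) \<in> mono_ideal I" if "m \<in> keys p" for m
    proof -
      have "single 0 (lookup p m) * single m 1 \<in> mono_ideal I"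
        using that p gen by (intro K(3)) (auto simp: monomials_def)
      then show ?thesis by (simp add: mult_single)
    qed
    have "(\<Sum>m\<in>M. single m (lookup p m)) \<in> mono_ideal I" if "M \<subseteq> keys p" for M
      using finite_subset[OF that finite_keys] that
      by (induction M rule: finite_induct) (auto intro: K(1,2) monomial)
    from this[of "keys p"] show "p \<in> mono_ideal I" by (simp add: sum_monomials)
  }
qed

lemma graded_ideal_mono_ideal:
  fixes I :: "('n::finite, 'k::field) mpoly set"
  assumes "ideal I mpoly_ring"
  shows "graded_ideal (mono_ideal I)"
proof -
  interpret R: cring "mpoly_ring :: ('n, 'k) mpoly ring" ..
  have "ideal (mono_ideal I) (mpoly_ring :: ('n, 'k) mpoly ring)"
    unfolding mono_ideal_def by (rule R.genideal_ideal) (simp add: ring_of_type_algebra_def)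
  then show ?thesis
    by (simp add: graded_ideal_def hom_component_eq_hpart mem_mono_ideal_iff[OF assms] keys_hpart)
qed

text \<open>Some monomial of \<open>u\<close> is outside \<open>I\<close>. Multiplying by a variable
  only shifts exponents, so its multiple occurs in \<open>indet l * u\<close> and therefore lies in
  \<open>I\<close>.\<close>

lemma mono_ideal_socle_monomial:
  assumes I: "ideal I (mpoly_ring :: ('n::finite, 'k::field) mpoly ring)"
    and "u \<notin> mono_ideal I" and socle: "\<And>l. indet l * u \<in> mono_ideal I"
  obtains m where "m \<in> keys u" and "single m 1 \<notin> I" and "\<And>l. indet l * single m 1 \<in> I"
proof -
  from assms(2) obtain m where m: "m \<in> keys u" "single m 1 \<notin> I"
    by (auto simp: mem_mono_ideal_iff[OF I])
  have "indet l * single m 1 \<in> I" for l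
  proof -
    have "single l 1 + m \<in> keys (indet l * u)"
      using m(1) by (simp add: indet_def in_keys_iff lookup_single_times_add)
    with socle[of l] have "single (single l 1 + m) 1 \<in> I"
      by (simp add: mem_mono_ideal_iff[OF I])
    then show ?thesis by (simp add: indet_def mult_single)
  qed
  with m that show thesis by blast
qed

lemma betti_quot_CARD_neq_0_iff:
  fixes J :: "('n::finite, 'k::field) mpoly set"
  assumes "graded_ideal J"
  shows "betti_quot CARD('n) j J \<noteq> 0 \<longleftrightarrow>
    (\<exists>u. homogeneous (j - int CARD('n)) u \<and> u \<notin> J \<and> (\<forall>l. indet l * u \<in> J))"
proof -
  have "graded_free_resolution J (SOME F. graded_free_resolution J F)"
    using ex_graded_free_resolution[OF assms] by (rule someI_ex)
  then interpret free_resolution J "SOME F. graded_free_resolution J F"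
    using assms by unfold_locales
  show ?thesis
    unfolding betti_quot_def by (rule tor_dim_CARD_neq_0_iff)
qed

theorem proposition3p2:
  fixes I :: "('n::finite, 'k::field) mpoly set" and j :: int
  assumes "graded_ideal I" and "artinian_ideal I"
    and "betti_quot CARD('n) j (mono_ideal I) \<noteq> 0"
  shows "betti_quot CARD('n) j I \<noteq> 0"
proof -
  have I: "ideal I mpoly_ring" using assms(1) by (simp add: graded_ideal_def)
  obtain u where u: "homogeneous (j - int CARD('n)) u" "u \<notin> mono_ideal I"
      "\<And>l. indet l * u \<in> mono_ideal I"
    using assms(3) betti_quot_CARD_neq_0_iff[OF graded_ideal_mono_ideal[OF I]] by blast
  obtain m where m: "m \<in> keys u" "single m 1 \<notin> I" "\<And>l. indet l * single m 1 \<in> I"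
    using mono_ideal_socle_monomial[OF I u(2,3)] by blast
  \<comment> \<open>As \<open>m\<close> occurs in the homogeneous \<open>u\<close>, it has the same
    degree, so the same \<open>j\<close> works for \<open>I\<close>.\<close>
  have "homogeneous (j - int CARD('n)) (single m 1 :: ('n, 'k) mpoly)"
    using u(1) m(1) by (simp add: homogeneous_def)
  with m(2,3) show ?thesis
    unfolding betti_quot_CARD_neq_0_iff[OF assms(1)] by blast
qed

end
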